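(* Fix an integer $s \ge 2$. There is an integer $n_0(s)$ such that for all $n \ge n_0(s)$ the following holds. Let $\mathcal{P}$ be a set of $n$ points and let $\mathcal{L}$ be a set of $m$ lines in the plane $\mathbb{R}^2$ such that no line in $\mathcal{L}$ contains more than $\frac{n-1}{s-1}$ points of $\mathcal{P}$. Suppose that for every $s$-set $S$ of points from $\mathcal{P}$, there is a pair of (distinct) points in $S$ that lies in some line from $\mathcal{L}$. Then $$m \ge \frac{n-1}{s-1} + s-1.$$ Moreover, if $n-1$ is a multiple of $s-1$, this is tight: for every sufficiently large $n$ (in terms of $s$) with $(s-1)\mid(n-1)$ there exist such $\mathcal{P}$ and $\mathcal{L}$ with $m = \frac{n-1}{s-1}+s-1$.
   Context: An $s$-set is a set of size $s$. *)

theory Defs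
  imports "HOL-Analysis.Analysis"
begin

definition line :: "(real ^ 2) set \<Rightarrow> bool" where
  "line l \<longleftrightarrow> affine l \<and> aff_dim l = 1"

definition admissible :: "nat \<Rightarrow> nat \<Rightarrow> nat \<Rightarrow> (real ^ 2) set \<Rightarrow> (real ^ 2) set set \<Rightarrow> bool" where
  "admissible s n m P L \<longleftrightarrow>
     finite P \<and> card P = n \<and>
     finite L \<and> card L = m \<and> (\<forall>l\<in>L. line l) \<and>
     (\<forall>l\<in>L. real (card (P \<inter> l)) \<le> (real n - 1) / (real s - 1)) \<and>
     (\<forall>S. S \<subseteq> P \<and> card S = s \<longrightarrow>
        (\<exists>x\<in>S. \<exists>y\<in>S. x \<noteq> y \<and> (\<exists>l\<in>L. x \<in> l \<and> y \<in> l)))"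

end

theory Submission
  imports Defs
begin

text \<open>
  Write \<open>t = s - 1\<close> and \<open>k = (n - 1) / t\<close>, and call two points adjacent if a line of \<open>L\<close> contains both, so
  that there are at most \<open>t\<close> pairwise non-adjacent points.

  Two lines can cut a finite point set into four parts of at least a tenth of the points each, unless
  one line already contains a tenth of them, and every other line misses one of the four parts.
  Iterating this and applying Cauchy--Schwarz shows that all lines but boundedly many cover only
  \<open>\<epsilon> n\<^sup>2\<close> pairs of points (a weak form of the Szemeredi--Trotter theorem). If \<open>m = O(n)\<close>, then up
  to few exceptions the neighbourhood of a point is a line with at most \<open>k\<close> points, so some \<open>t\<close> lines
  of \<open>L\<close> cover all but a small set \<open>U\<close> of the points. The capacity bound forces \<open>U \<noteq> {}\<close>.

  It remains to find \<open>k\<close> further lines. If \<open>U\<close> is a single point, the \<open>t\<close> lines are disjoint with exactly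
  \<open>k\<close> points each, and fewer than \<open>k\<close> further lines would leave on each of them a point on no further
  line; these points and the point of \<open>U\<close> would be pairwise non-adjacent. Otherwise each of two points
  of \<open>U\<close> lies on at least \<open>3k/5\<close> further lines, and they share at most one.
\<close>

subsection \<open>Lines in the plane\<close>

text \<open>In the plane \<open>aff_dim\<close> 1 is codimension one, so such a set is a hyperplane
  \<open>{x. v \<bullet> x = c}\<close>. The coordinate form serves the sign arguments and the
  explicit lines below.\<close>

lemma line_iff_equation:
  "line l \<longleftrightarrow> (\<exists>a b c. (a \<noteq> 0 \<or> b \<noteq> 0) \<and> l = {x. a * x $ 1 + b * x $ 2 = c})"
proof
  assume "line l"
  then have hull: "affine hull l = l" and "aff_dim l = int DIM(real^2) - 1"
    by (auto simp: line_def affine_hull_eq)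
  then have "\<exists>v c. v \<noteq> 0 \<and> l = {x. v \<bullet> x = c}"
    using aff_dim_eq_hyperplane[of l] unfolding hull by simp
  then obtain v c where v: "v \<noteq> 0" "l = {x. v \<bullet> x = c}" by blast
  then show "\<exists>a b c. (a \<noteq> 0 \<or> b \<noteq> 0) \<and> l = {x. a * x $ 1 + b * x $ 2 = c}"
    by (intro exI[of _ "v $ 1"] exI[of _ "v $ 2"] exI[of _ c])
       (auto simp: inner_vec_def sum_2 vec_eq_iff forall_2)
next
  assume "\<exists>a b c. (a \<noteq> 0 \<or> b \<noteq> 0) \<and> l = {x. a * x $ 1 + b * x $ 2 = c}"
  then obtain a b c where ab: "a \<noteq> 0 \<or> b \<noteq> 0" "l = {x. a * x $ 1 + b * x $ 2 = c}" by blast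
  define v :: "real^2" where "v = vector [a, b]"
  have "v \<noteq> 0" using ab by (auto simp: v_def vec_eq_iff forall_2)
  moreover have "l = {x. v \<bullet> x = c}" using ab by (auto simp: v_def inner_vec_def sum_2)
  ultimately show "line l" unfolding line_def
    by (auto simp: affine_hyperplane aff_dim_hyperplane)
qed

lemma line_unique:
  assumes "line l" "line l'" "x \<in> l" "y \<in> l" "x \<in> l'" "y \<in> l'" "x \<noteq> y"
  shows "l = l'"
proof -
  have "affine hull {x, y} = g" if "line g" "x \<in> g" "y \<in> g" for g
  proof (rule affine_dim_equal)
    show "affine hull {x, y} \<subseteq> g" using that by (intro hull_minimal) (auto simp: line_def)
    show "aff_dim (affine hull {x, y}) = aff_dim g"
      using that assms(7) by (simp add: aff_dim_2 line_def)
  qed (use that in \<open>auto simp: line_def\<close>)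
  then show ?thesis using assms by metis
qed

lemma card_Int_lines_le_1:
  assumes "line l" "line l'" "l \<noteq> l'" "A \<subseteq> l" "A \<subseteq> l'"
  shows "finite A" "card A \<le> 1"
proof -
  have eq: "x = y" if "x \<in> A" "y \<in> A" for x y
    using assms that line_unique by blast
  have "A = {} \<or> (\<exists>x. A = {x})" using eq by blast
  then show "finite A" "card A \<le> 1" by auto
qed

subsection \<open>Cutting a finite point set with two lines\<close>

lemma continuous_on_Min:
  fixes f :: "'i \<Rightarrow> 'a::topological_space \<Rightarrow> real"
  assumes "finite I" "I \<noteq> {}" "\<And>i. i \<in> I \<Longrightarrow> continuous_on S (f i)"
  shows "continuous_on S (\<lambda>x. Min ((\<lambda>i. f i x) ` I))"
  using assms
proof (induction I rule: finite_ne_induct)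
  case (insert i I)
  then have "continuous_on S (\<lambda>x. min (f i x) (Min ((\<lambda>i. f i x) ` I)))"
    by (intro continuous_on_min) auto
  with insert show ?case by simp
qed auto

lemma continuous_on_Max:
  fixes f :: "'i \<Rightarrow> 'a::topological_space \<Rightarrow> real"
  assumes "finite I" "I \<noteq> {}" "\<And>i. i \<in> I \<Longrightarrow> continuous_on S (f i)"
  shows "continuous_on S (\<lambda>x. Max ((\<lambda>i. f i x) ` I))"
  using assms
proof (induction I rule: finite_ne_induct)
  case (insert i I)
  then have "continuous_on S (\<lambda>x. max (f i x) (Max ((\<lambda>i. f i x) ` I)))"
    by (intro continuous_on_max) auto
  with insert show ?case by simp
qed auto

text \<open>The median is written as a minimum of maxima, which makes its continuity in \<open>f\<close> evident.\<close>

definition median :: "'a set \<Rightarrow> ('a \<Rightarrow> real) \<Rightarrow> real" where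
  "median A f = Min ((\<lambda>T. Max (f ` T)) ` {T. T \<subseteq> A \<and> card T = (card A + 1) div 2})"

lemma median_subsets:
  assumes "finite A" "A \<noteq> {}"
  shows "finite {T. T \<subseteq> A \<and> card T = (card A + 1) div 2}"
    "{T. T \<subseteq> A \<and> card T = (card A + 1) div 2} \<noteq> {}"
    "\<And>T. T \<subseteq> A \<Longrightarrow> card T = (card A + 1) div 2 \<Longrightarrow> finite T \<and> T \<noteq> {}"
proof -
  have pos: "card A > 0" using assms by (simp add: card_gt_0_iff)
  show "finite {T. T \<subseteq> A \<and> card T = (card A + 1) div 2}"
    by (rule finite_subset[of _ "Pow A"]) (use assms in auto)
  have "(card A + 1) div 2 \<le> card A" using pos by linarith
  then show "{T. T \<subseteq> A \<and> card T = (card A + 1) div 2} \<noteq> {}"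
    by (metis (mono_tags, lifting) empty_iff mem_Collect_eq obtain_subset_with_card_n)
  show "finite T \<and> T \<noteq> {}" if "T \<subseteq> A" "card T = (card A + 1) div 2" for T
    using that pos assms finite_subset by fastforce
qed

lemma continuous_on_median:
  fixes f :: "'a \<Rightarrow> 'b::topological_space \<Rightarrow> real"
  assumes "finite A" "A \<noteq> {}" "\<And>x. x \<in> A \<Longrightarrow> continuous_on S (f x)"
  shows "continuous_on S (\<lambda>u. median A (\<lambda>x. f x u))"
  unfolding median_def
proof (rule continuous_on_Min[OF median_subsets(1,2)[OF assms(1,2)]])
  fix T assume "T \<in> {T. T \<subseteq> A \<and> card T = (card A + 1) div 2}"
  with median_subsets(3)[OF assms(1,2), of T] assms(3)
  show "continuous_on S (\<lambda>u. Max ((\<lambda>x. f x u) ` T))"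
    by (intro continuous_on_Max) auto
qed

lemma median_attained:
  assumes "finite A" "A \<noteq> {}"
  obtains T where "T \<subseteq> A" "card T = (card A + 1) div 2" "median A f = Max (f ` T)"
proof -
  have "median A f \<in> (\<lambda>T. Max (f ` T)) ` {T. T \<subseteq> A \<and> card T = (card A + 1) div 2}"
    unfolding median_def using median_subsets(1,2)[OF assms] by (intro Min_in) simp_all
  then show thesis using that by auto
qed

lemma median_in_image:
  assumes "finite A" "A \<noteq> {}"
  shows "median A f \<in> f ` A"
proof -
  obtain T where T: "T \<subseteq> A" "card T = (card A + 1) div 2" "median A f = Max (f ` T)"
    using median_attained[OF assms] .
  have "Max (f ` T) \<in> f ` T" using median_subsets(3)[OF assms T(1,2)] by (intro Max_in) auto
  then show ?thesis using T by auto
qed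

lemma card_le_median:
  assumes "finite A" "A \<noteq> {}"
  shows "card A \<le> 2 * card {x\<in>A. f x \<le> median A f}"
proof -
  obtain T where T: "T \<subseteq> A" "card T = (card A + 1) div 2" "median A f = Max (f ` T)"
    using median_attained[OF assms] .
  have "T \<subseteq> {x\<in>A. f x \<le> median A f}"
    using T median_subsets(3)[OF assms T(1,2)] by auto
  then have "card T \<le> card {x\<in>A. f x \<le> median A f}" using assms by (intro card_mono) auto
  then show ?thesis using T by linarith
qed

text \<open>If \<open>(card A + 1) div 2\<close> points lay strictly below the median, a set
  \<open>T\<close> chosen among them would have a smaller maximum than the minimal one.\<close>

lemma card_ge_median:
  assumes "finite A" "A \<noteq> {}"
  shows "card A \<le> 2 * card {x\<in>A. f x \<ge> median A f}"
proof -
  have "card {x\<in>A. f x < median A f} < (card A + 1) div 2"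
  proof (rule ccontr)
    assume "\<not> ?thesis"
    then have le: "(card A + 1) div 2 \<le> card {x\<in>A. f x < median A f}" by (rule leI)
    obtain T where T: "T \<subseteq> {x\<in>A. f x < median A f}" "card T = (card A + 1) div 2"
      using obtain_subset_with_card_n[OF le] .
    then have TA: "T \<subseteq> A" by auto
    have "Max (f ` T) < median A f"
      using median_subsets(3)[OF assms TA T(2)] T(1) by (subst Max_less_iff) auto
    moreover have "median A f \<le> Max (f ` T)"
      unfolding median_def using median_subsets(1)[OF assms] TA T(2) by (intro Min_le) auto
    ultimately show False by simp
  qed
  moreover have "card A = card {x\<in>A. f x < median A f} + card {x\<in>A. f x \<ge> median A f}"
    using assms by (subst card_Un_disjoint[symmetric]) (auto intro!: arg_cong[of _ _ card])
  ultimately show ?thesis by linarith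
qed

text \<open>Points exactly at the median are counted separately, because they will lie on a cutting
  line and belong to no cell.\<close>

lemma card_less_median:
  assumes "finite A" "A \<noteq> {}"
  shows "card A \<le> 2 * (card {x\<in>A. f x < median A f} + card {x\<in>A. f x = median A f})"
proof -
  have "card {x\<in>A. f x \<le> median A f} =
      card {x\<in>A. f x < median A f} + card {x\<in>A. f x = median A f}"
    using assms by (subst card_Un_disjoint[symmetric]) (auto intro!: arg_cong[of _ _ card])
  then show ?thesis using card_le_median[OF assms, of f] by simp
qed

lemma card_greater_median:
  assumes "finite A" "A \<noteq> {}"
  shows "card A \<le> 2 * (card {x\<in>A. f x > median A f} + card {x\<in>A. f x = median A f})"
proof -
  have "card {x\<in>A. f x \<ge> median A f} =
      card {x\<in>A. f x > median A f} + card {x\<in>A. f x = median A f}"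
    using assms by (subst card_Un_disjoint[symmetric]) (auto intro!: arg_cong[of _ _ card])
  then show ?thesis using card_ge_median[OF assms, of f] by simp
qed

text \<open>As the slope runs from very negative to very positive, the median of the left set passes
  from below the median of the right set to above it.\<close>

lemma common_median:
  fixes A B :: "(real^2) set"
  assumes A: "finite A" "A \<noteq> {}" and B: "finite B" "B \<noteq> {}"
    and sep: "\<And>x y. x \<in> A \<Longrightarrow> y \<in> B \<Longrightarrow> x $ 1 < y $ 1"
  obtains \<sigma> where "median A (\<lambda>x. x $ 2 - \<sigma> * x $ 1) = median B (\<lambda>x. x $ 2 - \<sigma> * x $ 1)"
proof -
  define g where "g \<sigma> = median A (\<lambda>x. x $ 2 - \<sigma> * x $ 1) - median B (\<lambda>x. x $ 2 - \<sigma> * x $ 1)"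
    for \<sigma>
  \<comment> \<open>\<open>M\<close> is the largest absolute slope of a segment from
    \<open>A\<close> to \<open>B\<close>. At \<open>\<sigma> = - M\<close> every value on
    \<open>A\<close> is at most every value on \<open>B\<close>, and at \<open>\<sigma> = M\<close>
    the order is reversed. Medians are attained values, so they inherit both comparisons.\<close>
  define M where "M = Max ((\<lambda>(x, y). \<bar>y $ 2 - x $ 2\<bar> / (y $ 1 - x $ 1)) ` (A \<times> B))"
  have M: "\<bar>y $ 2 - x $ 2\<bar> \<le> M * (y $ 1 - x $ 1)" if "x \<in> A" "y \<in> B" for x y
  proof -
    have "\<bar>y $ 2 - x $ 2\<bar> / (y $ 1 - x $ 1) \<le> M"
      unfolding M_def using A B that by (intro Max_ge) (auto intro!: image_eqI[of _ _ "(x, y)"])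
    then show ?thesis using sep[OF that] by (simp add: field_simps)
  qed
  have M0: "M \<ge> 0"
  proof -
    obtain x y where "x \<in> A" "y \<in> B" using A B by blast
    then show ?thesis using M[of x y] sep[of x y]
      by (smt (verit) mult_nonneg_nonneg mult_neg_pos)
  qed
  have "g (- M) \<le> 0"
  proof -
    obtain x y where "x \<in> A" "y \<in> B" "median A (\<lambda>x. x $ 2 - (- M) * x $ 1) = x $ 2 - (- M) * x $ 1"
       "median B (\<lambda>x. x $ 2 - (- M) * x $ 1) = y $ 2 - (- M) * y $ 1"
      using median_in_image[OF A] median_in_image[OF B] by (smt (verit) imageE)
    then show ?thesis using M[of x y] unfolding g_def by (simp add: algebra_simps)
  qed
  moreover have "0 \<le> g M"
  proof -
    obtain x y where "x \<in> A" "y \<in> B" "median A (\<lambda>x. x $ 2 - M * x $ 1) = x $ 2 - M * x $ 1"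
       "median B (\<lambda>x. x $ 2 - M * x $ 1) = y $ 2 - M * y $ 1"
      using median_in_image[OF A] median_in_image[OF B] by (smt (verit) imageE)
    then show ?thesis using M[of x y] unfolding g_def by (simp add: algebra_simps)
  qed
  moreover have "continuous_on {- M..M} g"
    unfolding g_def using A B by (intro continuous_intros continuous_on_median) auto
  ultimately obtain \<sigma> where "g \<sigma> = 0" using IVT'[of g "- M" 0 M] M0 by auto
  then show thesis using that unfolding g_def by simp
qed

text \<open>In the coordinates \<open>u = x $ 1 - a\<close> and
  \<open>v = x $ 2 - \<sigma> * x $ 1 - \<tau>\<close> the line is
  \<open>\<alpha> * u + q * v = \<gamma>\<close>. The missed quadrant is the one where both terms
  have the sign opposite to \<open>\<gamma>\<close>.\<close>

lemma line_misses_quadrant: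
  fixes l :: "(real^2) set"
  assumes "line l"
  obtains e d :: bool where
    "\<And>x. x \<in> l \<Longrightarrow> x $ 1 \<noteq> a \<Longrightarrow> x $ 2 - \<sigma> * x $ 1 \<noteq> \<tau> \<Longrightarrow>
      (x $ 1 > a, x $ 2 - \<sigma> * x $ 1 > \<tau>) \<noteq> (e, d)"
proof -
  obtain p q c where pq: "p \<noteq> 0 \<or> q \<noteq> 0" and l: "l = {x. p * x $ 1 + q * x $ 2 = c}"
    using assms line_iff_equation by blast
  define \<alpha> where "\<alpha> = p + q * \<sigma>"
  define \<gamma> where "\<gamma> = c - \<alpha> * a - q * \<tau>"
  have ab: "\<alpha> \<noteq> 0 \<or> q \<noteq> 0" using pq by (auto simp: \<alpha>_def)
  have eq: "\<alpha> * (x $ 1 - a) + q * (x $ 2 - \<sigma> * x $ 1 - \<tau>) = \<gamma>" if "x \<in> l" for x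
    using that unfolding l \<alpha>_def \<gamma>_def by (simp add: algebra_simps)
  \<comment> \<open>For \<open>\<gamma> = 0\<close> a strict inequality is needed; \<open>ab\<close>
    supplies it, since a nonzero coefficient gives a strictly negative term.\<close>
  have pos: False if "\<alpha> * u + q * v = \<gamma>" "u \<noteq> 0" "v \<noteq> 0"
      "(u > 0) = (if \<gamma> \<ge> 0 then \<alpha> \<le> 0 else \<alpha> \<ge> 0)"
      "(v > 0) = (if \<gamma> \<ge> 0 then q \<le> 0 else q \<ge> 0)" for u v
  proof (cases "\<gamma> \<ge> 0")
    case True
    have "\<alpha> * u \<le> 0" "q * v \<le> 0" "\<alpha> * u < 0 \<or> q * v < 0"
      using that True ab by (auto simp: mult_le_0_iff mult_less_0_iff)
    then show ?thesis using that(1) True by linarith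
  next
    case False
    have "\<alpha> * u \<ge> 0" "q * v \<ge> 0"
      using that False ab by (auto simp: zero_le_mult_iff)
    then show ?thesis using that(1) False by linarith
  qed
  show thesis
  proof (rule that)
    fix x assume x: "x \<in> l" "x $ 1 \<noteq> a" "x $ 2 - \<sigma> * x $ 1 \<noteq> \<tau>"
    show "(x $ 1 > a, x $ 2 - \<sigma> * x $ 1 > \<tau>) \<noteq>
      (if \<gamma> \<ge> 0 then \<alpha> \<le> 0 else \<alpha> \<ge> 0, if \<gamma> \<ge> 0 then q \<le> 0 else q \<ge> 0)"
    proof
      assume "(x $ 1 > a, x $ 2 - \<sigma> * x $ 1 > \<tau>) =
        (if \<gamma> \<ge> 0 then \<alpha> \<le> 0 else \<alpha> \<ge> 0, if \<gamma> \<ge> 0 then q \<le> 0 else q \<ge> 0)"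
      then show False using x(2,3) by (intro pos[OF eq[OF x(1)]]) simp_all
    qed
  qed
qed

text \<open>If a line holds a tenth of \<open>Q\<close>, it is removed and the rest is one cell.
  Otherwise a vertical median line and a line bisecting both halves leave four cells of at least a
  tenth each, and every line misses one. The bound is on the total size of the cells met, as the
  later Cauchy-Schwarz step requires.\<close>

lemma two_line_cut:
  fixes Q :: "(real^2) set"
  assumes Q: "finite Q"
  obtains H and col :: "real^2 \<Rightarrow> bool \<times> bool" where
    "finite H" "card H \<le> 2" "\<And>h. h \<in> H \<Longrightarrow> line h"
    "\<And>l. line l \<Longrightarrow>
      10 * (\<Sum>i | {x\<in>Q - \<Union>H. col x = i} \<inter> l \<noteq> {}. card {x\<in>Q - \<Union>H. col x = i}) \<le> 9 * card Q"
proof -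
  let ?cells = "\<lambda>H col. \<forall>l. line l \<longrightarrow>
      10 * (\<Sum>i | {x\<in>Q - \<Union>H. col x = i} \<inter> l \<noteq> {}. card {x\<in>Q - \<Union>H. col x = i}) \<le> 9 * card Q"
  have total: "(\<Sum>i\<in>UNIV. card {x\<in>Q - \<Union>H. col x = i}) = card (Q - \<Union>H)"
    for H and col :: "real^2 \<Rightarrow> bool \<times> bool"
  proof -
    have "Q - \<Union>H = (\<Union>i. {x\<in>Q - \<Union>H. col x = i})" by blast
    also have "card \<dots> = (\<Sum>i\<in>UNIV. card {x\<in>Q - \<Union>H. col x = i})"
      by (rule card_UN_disjoint) (use Q in auto)
    finally show ?thesis by simp
  qed
  show thesis
  proof (cases "\<exists>h. line h \<and> 10 * card (Q \<inter> h) \<ge> card Q")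
    case True
    then obtain h where h: "line h" "10 * card (Q \<inter> h) \<ge> card Q" by blast
    have "card Q = card (Q - h) + card (Q \<inter> h)"
      using Q by (simp add: card_Diff_subset_Int card_mono)
    then have small: "10 * card (Q - \<Union>{h}) \<le> 9 * card Q" using h by simp
    show thesis
    proof (rule that[of "{h}" "\<lambda>_. (True, True)"])
      fix l :: "(real^2) set"
      have "(\<Sum>i | {x\<in>Q - \<Union>{h}. (True, True) = i} \<inter> l \<noteq> {}. card {x\<in>Q - \<Union>{h}. (True, True) = i})
         \<le> (\<Sum>i\<in>UNIV. card {x\<in>Q - \<Union>{h}. (True, True) = i})"
        by (intro sum_mono2) auto
      then show "10 * (\<Sum>i | {x\<in>Q - \<Union>{h}. (True, True) = i} \<inter> l \<noteq> {}.
          card {x\<in>Q - \<Union>{h}. (True, True) = i}) \<le> 9 * card Q"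
        using total[of "{h}" "\<lambda>_. (True, True)"] small by linarith
    qed (use h in auto)
  next
    case False
    then have few: "10 * card (Q \<inter> h) < card Q" if "line h" for h
      using that by (meson not_le)
    have vertical: "line {x. x $ 1 = a}" for a :: real
      unfolding line_iff_equation by (rule exI[of _ 1], rule exI[of _ 0]) auto
    have sloped: "line {x. x $ 2 - \<sigma> * x $ 1 = \<tau>}" for \<sigma> \<tau> :: real
      unfolding line_iff_equation by (rule exI[of _ "-\<sigma>"], rule exI[of _ 1]) (auto simp: algebra_simps)
    have Qne: "Q \<noteq> {}" using few[OF vertical[of 0]] by auto
    define a where "a = median Q (\<lambda>x. x $ 1)"
    define A where "A = {x\<in>Q. x $ 1 < a}"
    define B where "B = {x\<in>Q. x $ 1 > a}"
    have on: "10 * card {x\<in>Q. x $ 1 = a} < card Q"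
      using few[OF vertical[of a]] by (simp add: Int_def)
    have "card Q \<le> 2 * (card A + card {x\<in>Q. x $ 1 = a})"
      using card_less_median[OF Q Qne, of "\<lambda>x. x $ 1"] unfolding A_def a_def .
    then have cA: "10 * card A > 4 * card Q" using on by simp
    have "card Q \<le> 2 * (card B + card {x\<in>Q. x $ 1 = a})"
      using card_greater_median[OF Q Qne, of "\<lambda>x. x $ 1"] unfolding B_def a_def .
    then have cB: "10 * card B > 4 * card Q" using on by simp
    have fin: "finite A" "finite B" using Q unfolding A_def B_def by auto
    have ne: "A \<noteq> {}" "B \<noteq> {}" using cA cB by auto
    obtain \<sigma> where \<sigma>: "median A (\<lambda>x. x $ 2 - \<sigma> * x $ 1) = median B (\<lambda>x. x $ 2 - \<sigma> * x $ 1)"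
      using common_median[OF fin(1) ne(1) fin(2) ne(2)] unfolding A_def B_def by fastforce
    define v where "v x = x $ 2 - \<sigma> * x $ 1" for x :: "real^2"
    define \<tau> where "\<tau> = median A v"
    have \<tau>B: "\<tau> = median B v" using \<sigma> unfolding \<tau>_def v_def by simp
    have on2: "10 * card {x\<in>Q. v x = \<tau>} < card Q"
      using few[OF sloped[of \<sigma> \<tau>]] by (simp add: Int_def v_def)
    have on2': "10 * card {x\<in>Z. v x = \<tau>} < card Q" if "Z \<subseteq> Q" for Z
    proof -
      have "card {x\<in>Z. v x = \<tau>} \<le> card {x\<in>Q. v x = \<tau>}"
        using Q that by (intro card_mono) auto
      then show ?thesis using on2 by linarith
    qed
    \<comment> \<open>Here \<open>q\<close> is \<open>card Q\<close>, \<open>b\<close> the size of a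
      half, \<open>g\<close> that of a quadrant and \<open>e\<close> the number of points of the
      half on the sloped line: \<open>g \<ge> b/2 - e > q/5 - q/10\<close>.\<close>
    have arith: "q \<le> 10 * g" if "b \<le> 2 * (g + e)" "10 * e < q" "4 * q < 10 * b" for b g e q :: nat
      using that by simp
    have AB: "A \<subseteq> Q" "B \<subseteq> Q" unfolding A_def B_def by auto
    define H where "H = {{x. x $ 1 = a}, {x. v x = \<tau>}}"
    define col where "col x = (x $ 1 > a, v x > \<tau>)" for x :: "real^2"
    have quad: "card Q \<le> 10 * card {x\<in>Q - \<Union>H. col x = (e, d)}" for e d
    proof -
      have "{x\<in>Q - \<Union>H. col x = (e, d)} =
        (if e then (if d then {x\<in>B. v x > \<tau>} else {x\<in>B. v x < \<tau>})
         else (if d then {x\<in>A. v x > \<tau>} else {x\<in>A. v x < \<tau>}))"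
        unfolding H_def col_def A_def B_def by auto
      moreover have "card Q \<le> 10 * card {x\<in>B. v x > \<tau>}"
        unfolding \<tau>B by (rule arith[OF card_greater_median[OF fin(2) ne(2), of v] on2'[OF AB(2), unfolded \<tau>B] cB])
      moreover have "card Q \<le> 10 * card {x\<in>B. v x < \<tau>}"
        unfolding \<tau>B by (rule arith[OF card_less_median[OF fin(2) ne(2), of v] on2'[OF AB(2), unfolded \<tau>B] cB])
      moreover have "card Q \<le> 10 * card {x\<in>A. v x > \<tau>}"
        unfolding \<tau>_def by (rule arith[OF card_greater_median[OF fin(1) ne(1), of v] on2'[OF AB(1), unfolded \<tau>_def] cA])
      moreover have "card Q \<le> 10 * card {x\<in>A. v x < \<tau>}"
        unfolding \<tau>_def by (rule arith[OF card_less_median[OF fin(1) ne(1), of v] on2'[OF AB(1), unfolded \<tau>_def] cA])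
      ultimately show ?thesis by simp
    qed
    show thesis
    proof (rule that[of H col])
      show "finite H" "card H \<le> 2" by (auto simp: H_def card_insert_if)
      show "line h" if "h \<in> H" for h
        using that vertical sloped unfolding H_def v_def by auto
      fix l :: "(real^2) set" assume "line l"
      then obtain e d where ed: "\<And>x. x \<in> l \<Longrightarrow> x $ 1 \<noteq> a \<Longrightarrow> v x \<noteq> \<tau> \<Longrightarrow> (x $ 1 > a, v x > \<tau>) \<noteq> (e, d)"
        unfolding v_def using line_misses_quadrant[of l a \<sigma> \<tau>] by blast
      have "{x\<in>Q - \<Union>H. col x = (e, d)} \<inter> l = {}"
        using ed unfolding H_def col_def by auto
      then have sub: "{i. {x\<in>Q - \<Union>H. col x = i} \<inter> l \<noteq> {}} \<subseteq> UNIV - {(e, d)}" by blast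
      have "(\<Sum>i | {x\<in>Q - \<Union>H. col x = i} \<inter> l \<noteq> {}. card {x\<in>Q - \<Union>H. col x = i})
         \<le> (\<Sum>i\<in>UNIV - {(e, d)}. card {x\<in>Q - \<Union>H. col x = i})"
        using sub by (intro sum_mono2) auto
      moreover have "(\<Sum>i\<in>UNIV. card {x\<in>Q - \<Union>H. col x = i}) =
          card {x\<in>Q - \<Union>H. col x = (e, d)} + (\<Sum>i\<in>UNIV - {(e, d)}. card {x\<in>Q - \<Union>H. col x = i})"
        by (rule sum.remove) auto
      moreover have "card (Q - \<Union>H) \<le> card Q" using Q by (intro card_mono) auto
      ultimately show "10 * (\<Sum>i | {x\<in>Q - \<Union>H. col x = i} \<inter> l \<noteq> {}. card {x\<in>Q - \<Union>H. col x = i})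
          \<le> 9 * card Q"
        using total[of H col] quad[of e d] by linarith
    qed
  qed
qed

subsection \<open>All but boundedly many lines cover few pairs\<close>

text \<open>The ordered pairs of distinct points on a line determine that line, so the sets
  \<open>D l\<close> are disjoint in \<open>Q \<times> Q\<close>; each has at least
  \<open>(card (Q \<inter> l) - 1)^2\<close> elements.\<close>

lemma sum_card_minus_one_squared_le:
  fixes Q :: "(real^2) set"
  assumes "finite Q" "finite L" "\<And>l. l \<in> L \<Longrightarrow> line l"
  shows "(\<Sum>l\<in>L. (card (Q \<inter> l) - 1)^2) \<le> (card Q)^2"
proof -
  define D where "D l = {z \<in> (Q \<inter> l) \<times> (Q \<inter> l). fst z \<noteq> snd z}" for l
  have finD: "finite (D l)" for l
    unfolding D_def using assms(1) by (intro finite_Collect_conjI) auto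
  have cardD: "card (D l) = card (Q \<inter> l) * (card (Q \<inter> l) - 1)" for l
  proof -
    have eq: "D l = (Q \<inter> l) \<times> (Q \<inter> l) - (\<lambda>x. (x, x)) ` (Q \<inter> l)" unfolding D_def by auto
    moreover have "card ((\<lambda>x. (x, x)) ` (Q \<inter> l)) = card (Q \<inter> l)"
      by (intro card_image) (auto simp: inj_on_def)
    ultimately show ?thesis using assms(1)
      unfolding eq by (subst card_Diff_subset) (auto simp: card_cartesian_product diff_mult_distrib2)
  qed
  have "(\<Sum>l\<in>L. (card (Q \<inter> l) - 1)^2) \<le> (\<Sum>l\<in>L. card (D l))"
    unfolding cardD power2_eq_square by (intro sum_mono mult_right_mono) auto
  also have "\<dots> = card (\<Union>l\<in>L. D l)"
  proof (rule card_UN_disjoint[symmetric])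
    show "\<forall>i\<in>L. \<forall>j\<in>L. i \<noteq> j \<longrightarrow> D i \<inter> D j = {}"
      unfolding D_def using line_unique[OF assms(3) assms(3)] by fastforce
  qed (use assms finD in auto)
  also have "\<dots> \<le> card (Q \<times> Q)"
    unfolding D_def using assms by (intro card_mono) auto
  finally show ?thesis by (simp add: card_cartesian_product power2_eq_square)
qed

text \<open>Cauchy-Schwarz for the factorization
  \<open>b i = sqrt (q i) * (b i / sqrt (q i))\<close>.\<close>

lemma sum_squared_le_weighted:
  fixes q b :: "'i \<Rightarrow> real"
  assumes "finite I" "\<And>i. i \<in> I \<Longrightarrow> q i > 0"
  shows "(\<Sum>i\<in>I. b i)^2 \<le> (\<Sum>i\<in>I. q i) * (\<Sum>i\<in>I. (b i)^2 / q i)"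
proof -
  have "(\<Sum>i\<in>I. b i) = (\<Sum>i\<in>I. sqrt (q i) * (b i / sqrt (q i)))"
    using assms(2) by (intro sum.cong) (auto simp: less_imp_neq[symmetric])
  also have "\<dots>^2 \<le> (\<Sum>i\<in>I. (sqrt (q i))^2) * (\<Sum>i\<in>I. (b i / sqrt (q i))^2)"
    by (rule Cauchy_Schwarz_ineq_sum)
  also have "(\<Sum>i\<in>I. (sqrt (q i))^2) = (\<Sum>i\<in>I. q i)"
    using assms(2) by (intro sum.cong) (auto intro: less_imp_le)
  also have "(\<Sum>i\<in>I. (b i / sqrt (q i))^2) = (\<Sum>i\<in>I. (b i)^2 / q i)"
    using assms(2) by (intro sum.cong) (auto simp: power_divide intro: less_imp_le)
  finally show ?thesis .
qed

text \<open>Each round of cutting gains a factor 9/10, because an unexceptional line only meets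
  cells of total size at most nine tenths. The truncated subtraction of \<open>r\<close> forgives
  the points lost on cutting lines. Both \<open>C\<close> and \<open>r\<close> depend on
  \<open>j\<close> but not on \<open>Q\<close>.\<close>

lemma few_heavy_lines:
  "\<exists>C r. \<forall>Q :: (real^2) set. finite Q \<longrightarrow>
     (\<exists>H. finite H \<and> card H \<le> C \<and>
       (\<forall>L. finite L \<and> (\<forall>l\<in>L. line l) \<and> L \<inter> H = {} \<longrightarrow>
          (\<Sum>l\<in>L. (real (card (Q \<inter> l) - r))^2) \<le> (9/10)^j * (real (card Q))^2))"
proof (induction j)
  case 0
  show ?case
  proof (rule exI[of _ 0], rule exI[of _ 1], intro allI impI)
    fix Q :: "(real^2) set" assume Q: "finite Q"
    have "(\<Sum>l\<in>L. (real (card (Q \<inter> l) - 1))^2) \<le> (real (card Q))^2"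
      if "finite L" "\<forall>l\<in>L. line l" for L
      using sum_card_minus_one_squared_le[of Q L] Q that
      by (simp flip: of_nat_power of_nat_sum)
    then show "\<exists>H. finite H \<and> card H \<le> 0 \<and>
       (\<forall>L. finite L \<and> (\<forall>l\<in>L. line l) \<and> L \<inter> H = {} \<longrightarrow>
          (\<Sum>l\<in>L. (real (card (Q \<inter> l) - 1))^2) \<le> (9/10)^0 * (real (card Q))^2)"
      by (intro exI[of _ "{}"]) auto
  qed
next
  case (Suc j)
  then obtain C r where IH: "\<And>Q :: (real^2) set. finite Q \<Longrightarrow>
     (\<exists>H. finite H \<and> card H \<le> C \<and>
       (\<forall>L. finite L \<and> (\<forall>l\<in>L. line l) \<and> L \<inter> H = {} \<longrightarrow>
          (\<Sum>l\<in>L. (real (card (Q \<inter> l) - r))^2) \<le> (9/10)^j * (real (card Q))^2))"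
    by blast
  define \<delta> :: real where "\<delta> = (9/10)^j"
  have \<delta>: "\<delta> \<ge> 0" by (simp add: \<delta>_def)
  \<comment> \<open>The exceptional lines are the two cutting lines and those of the four cells. A
    further line loses at most two points on the cutting lines and forgives \<open>r\<close> points
    in each cell.\<close>
  show ?case
  proof (rule exI[of _ "2 + 4 * C"], rule exI[of _ "2 + 4 * r"], intro allI impI)
    fix Q :: "(real^2) set" assume Q: "finite Q"
    obtain H and col :: "real^2 \<Rightarrow> bool \<times> bool" where H: "finite H" "card H \<le> 2" "\<And>h. h \<in> H \<Longrightarrow> line h"
      and cut: "\<And>l. line l \<Longrightarrow>
      10 * (\<Sum>i | {x\<in>Q - \<Union>H. col x = i} \<inter> l \<noteq> {}. card {x\<in>Q - \<Union>H. col x = i}) \<le> 9 * card Q"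
      using two_line_cut[OF Q] by blast
    define cell where "cell i = {x\<in>Q - \<Union>H. col x = i}" for i
    have fincell: "finite (cell i)" for i unfolding cell_def using Q by simp
    obtain G where G: "\<And>i. finite (G i)" "\<And>i. card (G i) \<le> C"
      "\<And>i L. finite L \<Longrightarrow> (\<forall>l\<in>L. line l) \<Longrightarrow> L \<inter> G i = {} \<Longrightarrow>
          (\<Sum>l\<in>L. (real (card (cell i \<inter> l) - r))^2) \<le> \<delta> * (real (card (cell i)))^2"
      using IH[OF fincell] unfolding \<delta>_def by metis
    define H' where "H' = H \<union> (\<Union>i. G i)"
    have cardH': "card H' \<le> 2 + 4 * C"
    proof -
      have "card (\<Union>i. G i) \<le> (\<Sum>i\<in>UNIV. card (G i))" by (rule card_UN_le) simp
      also have "\<dots> \<le> (\<Sum>i\<in>(UNIV :: (bool \<times> bool) set). C)" by (intro sum_mono G(2))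
      also have "\<dots> = 4 * C" by (simp add: card_UNIV_bool card_prod)
      finally show ?thesis unfolding H'_def using card_Un_le[of H "\<Union>i. G i"] H(2) by linarith
    qed
    have "(\<Sum>l\<in>L. (real (card (Q \<inter> l) - (2 + 4 * r)))^2) \<le> (9/10) ^ Suc j * (real (card Q))^2"
      if L: "finite L" "\<forall>l\<in>L. line l" "L \<inter> H' = {}" for L
    proof -
      define b where "b i l = real (card (cell i \<inter> l) - r)" for i l
      define q where "q i = real (card (cell i))" for i
      have line_bound: "(real (card (Q \<inter> l) - (2 + 4 * r)))^2
          \<le> 9/10 * real (card Q) * (\<Sum>i\<in>UNIV. (b i l)^2 / q i)" if l: "l \<in> L" for l
      proof -
        \<comment> \<open>Only cells met by \<open>l\<close> count, so their weights
          \<open>q i\<close> are positive and their sum is controlled by \<open>cut\<close>. When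
          the sum is later extended to all cells, an empty one contributes 0, as division by zero
          gives 0.\<close>
        define I where "I = {i. cell i \<inter> l \<noteq> {}}"
        have q_pos: "q i > 0" if "i \<in> I" for i
          using that fincell unfolding I_def q_def by (auto simp: card_gt_0_iff)
        have "Q \<inter> l \<subseteq> (\<Union>h\<in>H. h \<inter> l) \<union> (\<Union>i\<in>I. cell i \<inter> l)"
          unfolding I_def cell_def by auto
        moreover have fin: "finite (h \<inter> l)" "card (h \<inter> l) \<le> 1" if "h \<in> H" for h
          using card_Int_lines_le_1[of h l "h \<inter> l"] H(3)[OF that] L(2,3) l that
          unfolding H'_def by (metis IntI Int_lower1 Int_lower2 UnI1 empty_iff)+
        ultimately have "card (Q \<inter> l) \<le> card ((\<Union>h\<in>H. h \<inter> l) \<union> (\<Union>i\<in>I. cell i \<inter> l))"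
          using H(1) fincell by (intro card_mono finite_UnI finite_UN_I) auto
        also have "\<dots> \<le> card (\<Union>h\<in>H. h \<inter> l) + card (\<Union>i\<in>I. cell i \<inter> l)" by (rule card_Un_le)
        also have "card (\<Union>h\<in>H. h \<inter> l) \<le> (\<Sum>h\<in>H. card (h \<inter> l))" by (rule card_UN_le[OF H(1)])
        also have "\<dots> \<le> (\<Sum>h\<in>H. 1)" by (intro sum_mono fin(2))
        also have "\<dots> \<le> 2" using H(2) by simp
        also have "card (\<Union>i\<in>I. cell i \<inter> l) \<le> (\<Sum>i\<in>I. card (cell i \<inter> l))" by (rule card_UN_le) simp
        also have "\<dots> \<le> (\<Sum>i\<in>I. (card (cell i \<inter> l) - r) + r)" by (intro sum_mono) linarith
        also have "\<dots> = (\<Sum>i\<in>I. card (cell i \<inter> l) - r) + card I * r" by (simp add: sum.distrib)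
        also have "card I * r \<le> 4 * r"
          using card_mono[of UNIV I] by (intro mult_right_mono) (auto simp: card_UNIV_bool card_prod)
        finally have "card (Q \<inter> l) - (2 + 4 * r) \<le> (\<Sum>i\<in>I. card (cell i \<inter> l) - r)" by simp
        then have "real (card (Q \<inter> l) - (2 + 4 * r)) \<le> (\<Sum>i\<in>I. b i l)"
          unfolding b_def of_nat_sum[symmetric] of_nat_le_iff .
        then have "(real (card (Q \<inter> l) - (2 + 4 * r)))^2 \<le> (\<Sum>i\<in>I. b i l)^2"
          by (intro power_mono) auto
        also have "\<dots> \<le> (\<Sum>i\<in>I. q i) * (\<Sum>i\<in>I. (b i l)^2 / q i)"
          using q_pos by (intro sum_squared_le_weighted) auto
        also have "\<dots> \<le> 9/10 * real (card Q) * (\<Sum>i\<in>UNIV. (b i l)^2 / q i)"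
        proof (rule mult_mono)
          have "10 * (\<Sum>i\<in>I. card (cell i)) \<le> 9 * card Q"
            using cut[of l] L(2) l unfolding I_def cell_def by blast
          then have "real (10 * (\<Sum>i\<in>I. card (cell i))) \<le> real (9 * card Q)"
            unfolding of_nat_le_iff .
          then show "(\<Sum>i\<in>I. q i) \<le> 9/10 * real (card Q)" unfolding q_def by simp
          show "(\<Sum>i\<in>I. (b i l)^2 / q i) \<le> (\<Sum>i\<in>UNIV. (b i l)^2 / q i)"
            by (intro sum_mono2) (auto simp: q_def)
          show "0 \<le> (\<Sum>i\<in>I. (b i l)^2 / q i)" by (intro sum_nonneg) (auto simp: q_def)
        qed auto
        finally show ?thesis .
      qed
      have "(\<Sum>l\<in>L. (real (card (Q \<inter> l) - (2 + 4 * r)))^2)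
          \<le> (\<Sum>l\<in>L. 9/10 * real (card Q) * (\<Sum>i\<in>UNIV. (b i l)^2 / q i))"
        by (intro sum_mono line_bound)
      also have "\<dots> = 9/10 * real (card Q) * (\<Sum>l\<in>L. \<Sum>i\<in>UNIV. (b i l)^2 / q i)"
        by (rule sum_distrib_left[symmetric])
      also have "(\<Sum>l\<in>L. \<Sum>i\<in>UNIV. (b i l)^2 / q i) = (\<Sum>i\<in>UNIV. \<Sum>l\<in>L. (b i l)^2 / q i)"
        by (rule sum.swap)
      also have "\<dots> = (\<Sum>i\<in>UNIV. (\<Sum>l\<in>L. (b i l)^2) / q i)" by (simp add: sum_divide_distrib)
      also have "9/10 * real (card Q) * \<dots> \<le> 9/10 * real (card Q) * (\<delta> * real (card Q))"
      proof (rule mult_left_mono)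
        have "(\<Sum>i\<in>UNIV. (\<Sum>l\<in>L. (b i l)^2) / q i) \<le> (\<Sum>i\<in>UNIV. \<delta> * q i)"
        proof (rule sum_mono)
          fix i
          have "(\<Sum>l\<in>L. (b i l)^2) \<le> \<delta> * (q i)^2"
            unfolding b_def q_def using L by (intro G(3)) (auto simp: H'_def)
          then show "(\<Sum>l\<in>L. (b i l)^2) / q i \<le> \<delta> * q i"
            using \<delta> by (cases "q i = 0") (auto simp: q_def power2_eq_square divide_le_eq mult.assoc)
        qed
        also have "\<dots> = \<delta> * (\<Sum>i\<in>UNIV. q i)" by (rule sum_distrib_left[symmetric])
        also have "(\<Sum>i\<in>UNIV. q i) = real (card (\<Union>i. cell i))"
          unfolding q_def of_nat_sum[symmetric]
          by (subst card_UN_disjoint) (use fincell in \<open>auto simp: cell_def\<close>)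
        also have "\<dots> \<le> real (card Q)"
          unfolding of_nat_le_iff using Q by (intro card_mono) (auto simp: cell_def)
        finally show "(\<Sum>i\<in>UNIV. (\<Sum>l\<in>L. (b i l)^2) / q i) \<le> \<delta> * real (card Q)"
          using \<delta> by (simp add: mult_left_mono)
      qed simp
      finally show ?thesis by (simp add: \<delta>_def power2_eq_square mult_ac)
    qed
    moreover have "finite H'" unfolding H'_def using H(1) G(1) by simp
    ultimately show "\<exists>H. finite H \<and> card H \<le> 2 + 4 * C \<and>
       (\<forall>L. finite L \<and> (\<forall>l\<in>L. line l) \<and> L \<inter> H = {} \<longrightarrow>
          (\<Sum>l\<in>L. (real (card (Q \<inter> l) - (2 + 4 * r)))^2) \<le> (9/10) ^ Suc j * (real (card Q))^2)"
      using cardH' by blast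
  qed
qed

subsection \<open>The lines outside a nearly perfect cover\<close>

text \<open>Double counting of incidences. Weight 1 gives the total degree, weight
  \<open>card (P \<inter> l)\<close> an upper bound for the total number of neighbours.\<close>

lemma sum_incidences:
  fixes w :: "'a set \<Rightarrow> nat"
  assumes "finite A" "finite M"
  shows "(\<Sum>x\<in>A. \<Sum>l | l \<in> M \<and> x \<in> l. w l) = (\<Sum>l\<in>M. card (A \<inter> l) * w l)"
proof -
  have "(\<Sum>x\<in>A. \<Sum>l | l \<in> M \<and> x \<in> l. w l) = (\<Sum>l\<in>M. \<Sum>x | x \<in> A \<and> x \<in> l. w l)"
    using assms by (rule sum.swap_restrict)
  then show ?thesis by (simp add: Int_def)
qed

text \<open>Greedy choice: the points chosen so far forbid at most \<open>N * card I\<close>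
  elements of the next \<open>E i\<close>.\<close>

lemma independent_transversal:
  fixes E :: "'i \<Rightarrow> 'a set"
  assumes "finite I"
    and "\<And>i. i \<in> I \<Longrightarrow> card (E i) > N * card I"
    and deg: "\<And>i x. i \<in> I \<Longrightarrow> x \<in> (\<Union>j\<in>I. E j) \<Longrightarrow>
      finite {y \<in> E i. R x y} \<and> card {y \<in> E i. R x y} \<le> N"
    and R_sym: "\<And>x y. R x y \<Longrightarrow> R y x"
  shows "\<exists>f. (\<forall>i\<in>I. f i \<in> E i) \<and> (\<forall>i\<in>I. \<forall>j\<in>I. i \<noteq> j \<longrightarrow> \<not> R (f i) (f j))"
proof -
  have "\<exists>f. (\<forall>i\<in>J. f i \<in> E i) \<and> (\<forall>i\<in>J. \<forall>j\<in>J. i \<noteq> j \<longrightarrow> \<not> R (f i) (f j))" if "J \<subseteq> I" for J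
    using finite_subset[OF that assms(1)] that
  proof (induction J rule: finite_induct)
    case (insert i J)
    then obtain f where f: "\<forall>i\<in>J. f i \<in> E i" "\<forall>i\<in>J. \<forall>j\<in>J. i \<noteq> j \<longrightarrow> \<not> R (f i) (f j)" by auto
    let ?B = "\<Union>j\<in>J. {y \<in> E i. R (f j) y}"
    have i: "i \<in> I" and J: "J \<subseteq> I" using insert by auto
    have fin: "finite {y \<in> E i. R (f j) y}" "card {y \<in> E i. R (f j) y} \<le> N" if "j \<in> J" for j
      using deg[OF i, of "f j"] f(1) J that by blast+
    have "card ?B \<le> (\<Sum>j\<in>J. card {y \<in> E i. R (f j) y})" by (rule card_UN_le[OF insert(1)])
    also have "\<dots> \<le> (\<Sum>j\<in>J. N)" by (intro sum_mono fin(2))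
    also have "\<dots> \<le> N * card I" using card_mono[OF assms(1) J] by (simp add: mult.commute)
    also have "\<dots> < card (E i)" by (rule assms(2)[OF i])
    finally have lt: "card ?B < card (E i)" .
    have "finite ?B" using insert(1) fin(1) by blast
    then have "\<not> E i \<subseteq> ?B" using lt card_mono[of ?B "E i"] by linarith
    then obtain y where y: "y \<in> E i" "\<And>j. j \<in> J \<Longrightarrow> \<not> R (f j) y" by blast
    show ?case
      by (rule exI[of _ "f(i := y)"]) (use insert(2) f y in \<open>auto dest: R_sym\<close>)
  qed auto
  then show ?thesis by blast
qed

text \<open>If a point off the \<open>s - 1\<close> big lines is joined to fewer than \<open>3k/5\<close> of the other lines, then it
  misses at least \<open>k/5\<close> points on each big line; but then there is a transversal of the big lines
  avoiding the few remaining lines.\<close>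

lemma lines_outside_big_lines:
  fixes P :: "(real^2) set" and n s :: nat
  defines "k \<equiv> (real n - 1) / (real s - 1)"
  assumes adm: "admissible s n m P L" and s: "s \<ge> 2"
    and H: "H \<subseteq> L" "card H = s - 1"
    and small: "5 * real (card (P - \<Union>H)) \<le> k"
    and large: "k > 100 * (real s - 1)"
  shows "real (card (L - H)) \<ge> k"
proof (rule ccontr)
  assume few: "\<not> ?thesis"
  define t where "t = s - 1"
  define M where "M = L - H"
  define U where "U = P - \<Union>H"
  \<comment> \<open>The points of \<open>h\<close> on no other big line: a transversal through the
    sets \<open>Q h\<close> has exactly one point on each big line.\<close>
  define Q where "Q h = P \<inter> h - \<Union>(H - {h})" for h
  have cM: "real (card M) < k" using few unfolding M_def by simp
  have t: "s = Suc t" "t \<ge> 1" "real t = real s - 1" "card H = t" using s H by (auto simp: t_def)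
  have n: "real n = real t * k + 1" unfolding k_def t(3)[symmetric] using t(2) by simp
  have P: "finite P" "card P = n" and L: "finite L" "\<And>l. l \<in> L \<Longrightarrow> line l"
    and cap: "\<And>l. l \<in> L \<Longrightarrow> real (card (P \<inter> l)) \<le> k"
    and cov: "\<And>S. S \<subseteq> P \<Longrightarrow> card S = s \<Longrightarrow>
        \<exists>x\<in>S. \<exists>y\<in>S. x \<noteq> y \<and> (\<exists>l\<in>L. x \<in> l \<and> y \<in> l)"
    using adm unfolding admissible_def k_def by auto
  have finH: "finite H" and finM: "finite M" using L H unfolding M_def by (auto intro: finite_subset)
  have finQ: "finite (Q h)" for h unfolding Q_def using P by auto
  have k: "k > 100 * real t" "k > 100" using large t(2) unfolding t(3)[symmetric] by auto
  have meet: "finite (A \<inter> l)" "card (A \<inter> l) \<le> 1" if "A \<subseteq> h" "h \<in> H" "l \<in> M" for A h l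
    using card_Int_lines_le_1[of h l "A \<inter> l"] that L H unfolding M_def by blast+
  have cover_bound: "real (card (\<Union>g\<in>G. P \<inter> g)) \<le> real (card G) * k" if "G \<subseteq> H" for G
  proof -
    have "card (\<Union>g\<in>G. P \<inter> g) \<le> (\<Sum>g\<in>G. card (P \<inter> g))"
      using that finH finite_subset by (intro card_UN_le) blast
    then have "real (card (\<Union>g\<in>G. P \<inter> g)) \<le> (\<Sum>g\<in>G. real (card (P \<inter> g)))"
      unfolding of_nat_sum[symmetric] of_nat_le_iff .
    also have "\<dots> \<le> (\<Sum>g\<in>G. k)" using that H cap by (intro sum_mono) auto
    finally show ?thesis by simp
  qed
  \<comment> \<open>The other \<open>t - 1\<close> big lines cover at most
    \<open>(t - 1) * k\<close> of the \<open>t * k + 1\<close> points.\<close>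
  have cQ: "real (card (Q h)) \<ge> k + 1 - real (card U)" if h: "h \<in> H" for h
  proof -
    have "P \<subseteq> Q h \<union> ((\<Union>g\<in>H - {h}. P \<inter> g) \<union> U)" unfolding Q_def U_def by auto
    then have "n \<le> card (Q h \<union> ((\<Union>g\<in>H - {h}. P \<inter> g) \<union> U))"
      unfolding P(2)[symmetric] using P finQ finH by (intro card_mono) (auto simp: U_def)
    also have "\<dots> \<le> card (Q h) + (card (\<Union>g\<in>H - {h}. P \<inter> g) + card U)"
      by (intro order_trans[OF card_Un_le] add_left_mono card_Un_le)
    finally have "real n \<le> real (card (Q h)) + (real (card (\<Union>g\<in>H - {h}. P \<inter> g)) + real (card U))"
      unfolding of_nat_add[symmetric] of_nat_le_iff .
    moreover have "real (card (H - {h})) = real t - 1" using h t(2,4) finH by (simp add: of_nat_diff)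
    then have "real (card (\<Union>g\<in>H - {h}. P \<inter> g)) \<le> (real t - 1) * k"
      using cover_bound[of "H - {h}"] by auto
    ultimately show ?thesis using n by (simp add: algebra_simps)
  qed
  have cU: "card U \<ge> 1"
  proof -
    have "P \<subseteq> (\<Union>g\<in>H. P \<inter> g) \<union> U" unfolding U_def by auto
    then have "n \<le> card ((\<Union>g\<in>H. P \<inter> g) \<union> U)"
      unfolding P(2)[symmetric] using P finH by (intro card_mono) (auto simp: U_def)
    also have "\<dots> \<le> card (\<Union>g\<in>H. P \<inter> g) + card U" by (rule card_Un_le)
    finally have "real n \<le> real (card (\<Union>g\<in>H. P \<inter> g)) + real (card U)"
      unfolding of_nat_add[symmetric] of_nat_le_iff .
    then have "real (card U) \<ge> 1" using cover_bound[of H] n t(4) by simp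
    then show ?thesis by simp
  qed
  \<comment> \<open>The point \<open>p\<close> and the points \<open>f h\<close> form an
    \<open>s\<close>-set. Every big line contains only one of them, so the line joining two of them
    must belong to \<open>M\<close>.\<close>
  have transversal: "\<exists>l\<in>M. (\<exists>h\<in>H. p \<in> l \<and> f h \<in> l) \<or> (\<exists>h\<in>H. \<exists>g\<in>H. h \<noteq> g \<and> f h \<in> l \<and> f g \<in> l)"
    if p: "p \<in> U" and f: "\<And>h. h \<in> H \<Longrightarrow> f h \<in> Q h" for p f
  proof -
    have own: "f h \<in> P" "f h \<in> g \<longleftrightarrow> g = h" if "h \<in> H" "g \<in> H" for h g
      using f[OF that(1)] that unfolding Q_def by auto
    have inj: "inj_on f H" using own by (intro inj_onI) metis
    have pH: "p \<notin> f ` H" "p \<in> P" "\<And>h. h \<in> H \<Longrightarrow> p \<notin> h" using p own unfolding U_def by auto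
    have card_S: "card (insert p (f ` H)) = s"
      using pH finH inj t(1,4) by (simp add: card_image)
    have sub_S: "insert p (f ` H) \<subseteq> P" using pH own by auto
    obtain x y l where xy: "x \<in> insert p (f ` H)" "y \<in> insert p (f ` H)" "x \<noteq> y"
      "l \<in> L" "x \<in> l" "y \<in> l" using cov[OF sub_S card_S] by blast
    have "l \<notin> H"
    proof
      assume "l \<in> H"
      then have "z = f l" if "z \<in> insert p (f ` H)" "z \<in> l" for z
        using that pH own by auto
      then show False using xy by metis
    qed
    then have "l \<in> M" using xy(4) unfolding M_def by simp
    moreover consider h where "h \<in> H" "x = p" "y = f h" | h where "h \<in> H" "y = p" "x = f h"
      | h g where "h \<in> H" "g \<in> H" "x = f h" "y = f g" "h \<noteq> g"
      using xy(1-3) by blast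
    then have "(\<exists>h\<in>H. p \<in> l \<and> f h \<in> l) \<or> (\<exists>h\<in>H. \<exists>g\<in>H. h \<noteq> g \<and> f h \<in> l \<and> f g \<in> l)"
      by cases (use xy(5,6) in blast)+
    ultimately show ?thesis by (rule bexI[rotated])
  qed
  show False
  proof (cases "card U = 1")
    case True
    then obtain p where p: "p \<in> U" by (auto simp: card_1_singleton_iff)
    \<comment> \<open>With one uncovered point, \<open>cQ\<close> gives
      \<open>card (Q h) \<ge> k\<close>, while fewer than \<open>k\<close> lines in \<open>M\<close>
      meet \<open>h\<close> in at most one point of \<open>Q h\<close> each.\<close>
    have "\<exists>x\<in>Q h. \<forall>l\<in>M. x \<notin> l" if h: "h \<in> H" for h
    proof (rule ccontr)
      assume "\<not> ?thesis"
      then have sub: "Q h \<subseteq> (\<Union>l\<in>M. Q h \<inter> l)" by blast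
      have Qh: "Q h \<subseteq> h" unfolding Q_def by auto
      have "card (Q h) \<le> card (\<Union>l\<in>M. Q h \<inter> l)"
        using sub finQ finM by (intro card_mono) auto
      also have "\<dots> \<le> (\<Sum>l\<in>M. card (Q h \<inter> l))" by (rule card_UN_le[OF finM])
      also have "\<dots> \<le> (\<Sum>l\<in>M. 1)" by (intro sum_mono meet(2)[OF Qh h])
      finally show False using cQ[OF h] True cM by simp
    qed
    then obtain f where "\<And>h. h \<in> H \<Longrightarrow> f h \<in> Q h \<and> (\<forall>l\<in>M. f h \<notin> l)" by metis
    then show False using transversal[OF p, of f] by blast
  next
    case False
    \<comment> \<open>Some \<open>Q h\<close>, of size above \<open>4k/5\<close>, has fewer than
      \<open>k/5\<close> points not joined to \<open>p\<close>. Each line of \<open>M\<close>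
      through \<open>p\<close> accounts for at most one of the others.\<close>
    have deg: "real (card {l \<in> M. p \<in> l}) \<ge> 3/5 * k" if p: "p \<in> U" for p
    proof -
      \<comment> \<open>\<open>A h\<close> collects the candidates not joined to \<open>p\<close>;
        \<open>E h\<close> keeps those of low degree, so that a greedy choice can avoid all joins by
        \<open>M\<close>.\<close>
      define A where "A h = {x \<in> Q h. \<forall>l\<in>M. \<not> (p \<in> l \<and> x \<in> l)}" for h
      define E where "E h = {x \<in> A h. card {l. l \<in> M \<and> x \<in> l} \<le> 10}" for h
      have AQ: "A h \<subseteq> Q h" "Q h \<subseteq> h" "E h \<subseteq> A h" for h unfolding A_def Q_def E_def by auto
      have finA: "finite (A h)" "finite (E h)" for h
        using finQ AQ finite_subset by metis+
      have "\<exists>h\<in>H. real (card (A h)) < k / 5"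
      proof (rule ccontr)
        assume "\<not> ?thesis"
        then have bigA: "real (card (A h)) \<ge> k / 5" if "h \<in> H" for h using that by auto
        \<comment> \<open>Fewer than \<open>k/11\<close> points of \<open>A h\<close> lie on 11 or
          more lines of \<open>M\<close>, which leaves over \<open>k/5 - k/11 = 6k/55\<close>, and
          this exceeds \<open>10 * t\<close> because \<open>k > 100 * t\<close>.\<close>
        have cE: "card (E h) > 10 * card H" if h: "h \<in> H" for h
        proof -
          have "11 * card (A h - E h) = (\<Sum>x\<in>A h - E h. 11)" by simp
          also have "\<dots> \<le> (\<Sum>x\<in>A h - E h. card {l. l \<in> M \<and> x \<in> l})"
            by (intro sum_mono) (auto simp: E_def)
          also have "\<dots> \<le> (\<Sum>x\<in>A h. card {l. l \<in> M \<and> x \<in> l})"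
            using finA by (intro sum_mono2) auto
          also have "\<dots> = (\<Sum>l\<in>M. card (A h \<inter> l))"
            using sum_incidences[OF finA(1) finM, of "\<lambda>_. 1" h] by simp
          also have "\<dots> \<le> (\<Sum>l\<in>M. 1)"
            using AQ[of h] by (intro sum_mono meet(2)[of _ h] h) auto
          finally have "11 * card (A h - E h) \<le> card M" by simp
          then have "real (11 * card (A h - E h)) \<le> real (card M)" unfolding of_nat_le_iff .
          moreover have "card (A h) = card (E h) + card (A h - E h)"
            using finA AQ(3)[of h] by (metis card_Diff_subset card_mono le_add_diff_inverse)
          ultimately have "real (card (E h)) > 10 * real t"
            using bigA[OF h] cM k by simp
          then show ?thesis unfolding t(4) by linarith
        qed
        have "\<exists>f. (\<forall>h\<in>H. f h \<in> E h) \<and>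
          (\<forall>h\<in>H. \<forall>g\<in>H. h \<noteq> g \<longrightarrow> \<not> (\<exists>l\<in>M. f h \<in> l \<and> f g \<in> l))"
        proof (rule independent_transversal[OF finH cE])
          fix h x assume h: "h \<in> H" and x: "x \<in> (\<Union>g\<in>H. E g)"
          have Eh: "E h \<subseteq> h" using AQ by blast
          have sub: "{y \<in> E h. \<exists>l\<in>M. x \<in> l \<and> y \<in> l} \<subseteq> (\<Union>l\<in>{l. l \<in> M \<and> x \<in> l}. E h \<inter> l)" by auto
          have "card {y \<in> E h. \<exists>l\<in>M. x \<in> l \<and> y \<in> l} \<le> card (\<Union>l\<in>{l. l \<in> M \<and> x \<in> l}. E h \<inter> l)"
            by (rule card_mono[OF _ sub]) (use finM finA in auto)
          also have "\<dots> \<le> (\<Sum>l\<in>{l. l \<in> M \<and> x \<in> l}. card (E h \<inter> l))"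
            by (rule card_UN_le) (use finM in auto)
          also have "\<dots> \<le> (\<Sum>l\<in>{l. l \<in> M \<and> x \<in> l}. 1)"
            by (intro sum_mono meet(2)[OF Eh h]) auto
          also have "\<dots> \<le> 10" using x by (auto simp: E_def)
          finally show "finite {y \<in> E h. \<exists>l\<in>M. x \<in> l \<and> y \<in> l} \<and>
              card {y \<in> E h. \<exists>l\<in>M. x \<in> l \<and> y \<in> l} \<le> 10" using finA by auto
        qed auto
        then obtain f where f: "(\<forall>h\<in>H. f h \<in> E h) \<and>
          (\<forall>h\<in>H. \<forall>g\<in>H. h \<noteq> g \<longrightarrow> \<not> (\<exists>l\<in>M. f h \<in> l \<and> f g \<in> l))" ..
        have fQ: "f h \<in> Q h" if "h \<in> H" for h
          using bspec[OF conjunct1[OF f] that] AQ by blast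
        have fA: "\<not> (p \<in> l \<and> f h \<in> l)" if "h \<in> H" "l \<in> M" for h l
          using bspec[OF conjunct1[OF f] that(1)] that(2) unfolding E_def A_def by blast
        obtain l where l: "l \<in> M" and joined:
          "(\<exists>h\<in>H. p \<in> l \<and> f h \<in> l) \<or> (\<exists>h\<in>H. \<exists>g\<in>H. h \<noteq> g \<and> f h \<in> l \<and> f g \<in> l)"
          using transversal[OF p fQ] by blast
        from joined show False
        proof
          assume "\<exists>h\<in>H. p \<in> l \<and> f h \<in> l"
          then obtain h where h: "h \<in> H" and "p \<in> l \<and> f h \<in> l" ..
          then show False using fA[OF h l] by simp
        next
          assume "\<exists>h\<in>H. \<exists>g\<in>H. h \<noteq> g \<and> f h \<in> l \<and> f g \<in> l"
          then obtain h g where hg: "h \<in> H" "g \<in> H" "h \<noteq> g" and on: "f h \<in> l \<and> f g \<in> l" by blast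
          have "\<not> (\<exists>l\<in>M. f h \<in> l \<and> f g \<in> l)"
            using bspec[OF bspec[OF conjunct2[OF f] hg(1)] hg(2)] hg(3) by (rule mp)
          then show False using bexI[of "\<lambda>l. f h \<in> l \<and> f g \<in> l", OF on l] by (rule notE)
        qed
      qed
      then obtain h where h: "h \<in> H" "real (card (A h)) < k / 5" by blast
      have "Q h \<subseteq> A h \<union> (\<Union>l\<in>{l \<in> M. p \<in> l}. Q h \<inter> l)" unfolding A_def by auto
      then have "card (Q h) \<le> card (A h \<union> (\<Union>l\<in>{l \<in> M. p \<in> l}. Q h \<inter> l))"
        by (rule card_mono[rotated]) (use finM finA finQ in auto)
      also have "\<dots> \<le> card (A h) + card (\<Union>l\<in>{l \<in> M. p \<in> l}. Q h \<inter> l)" by (rule card_Un_le)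
      also have "card (\<Union>l\<in>{l \<in> M. p \<in> l}. Q h \<inter> l) \<le> (\<Sum>l\<in>{l \<in> M. p \<in> l}. card (Q h \<inter> l))"
        by (rule card_UN_le) (use finM in auto)
      also have "\<dots> \<le> (\<Sum>l\<in>{l \<in> M. p \<in> l}. 1)" by (intro sum_mono meet(2)[OF AQ(2) h(1)]) auto
      finally have "card (Q h) \<le> card (A h) + card {l \<in> M. p \<in> l}" by simp
      then have "real (card (Q h)) \<le> real (card (A h)) + real (card {l \<in> M. p \<in> l})"
        unfolding of_nat_add[symmetric] of_nat_le_iff .
      then show ?thesis using cQ[OF h(1)] h(2) small unfolding U_def by simp
    qed
    obtain p p' where pp: "p \<in> U" "p' \<in> U" "p \<noteq> p'"
      using False cU by (metis card_le_Suc0_iff_eq card.infinite le_antisym One_nat_def not_one_le_zero)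
    \<comment> \<open>Two distinct points determine a line; \<open>SOME\<close> names the possible
      common line without a case split on its existence.\<close>
    have "{l \<in> M. p \<in> l} \<inter> {l \<in> M. p' \<in> l} \<subseteq> {SOME l. l \<in> M \<and> p \<in> l \<and> p' \<in> l}"
    proof
      fix l assume l: "l \<in> {l \<in> M. p \<in> l} \<inter> {l \<in> M. p' \<in> l}"
      then have "(SOME l. l \<in> M \<and> p \<in> l \<and> p' \<in> l) \<in> M \<and> p \<in> (SOME l. l \<in> M \<and> p \<in> l \<and> p' \<in> l)
          \<and> p' \<in> (SOME l. l \<in> M \<and> p \<in> l \<and> p' \<in> l)"
        by (intro someI[of "\<lambda>l. l \<in> M \<and> p \<in> l \<and> p' \<in> l" l]) auto
      then have "l = (SOME l. l \<in> M \<and> p \<in> l \<and> p' \<in> l)"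
        using l pp L line_unique[of l _ p p'] unfolding M_def by blast
      then show "l \<in> {SOME l. l \<in> M \<and> p \<in> l \<and> p' \<in> l}" by blast
    qed
    then have "card ({l \<in> M. p \<in> l} \<inter> {l \<in> M. p' \<in> l}) \<le> 1"
      using card_mono[OF finite.insertI[OF finite.emptyI]] by fastforce
    moreover have "card {l \<in> M. p \<in> l} + card {l \<in> M. p' \<in> l} =
       card ({l \<in> M. p \<in> l} \<union> {l \<in> M. p' \<in> l}) + card ({l \<in> M. p \<in> l} \<inter> {l \<in> M. p' \<in> l})"
      using finM by (intro card_Un_Int) auto
    moreover have "card ({l \<in> M. p \<in> l} \<union> {l \<in> M. p' \<in> l}) \<le> card M"
      using finM by (intro card_mono) auto
    ultimately have "real (card {l \<in> M. p \<in> l}) + real (card {l \<in> M. p' \<in> l}) \<le> real (card M) + 1"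
      by linarith
    \<comment> \<open>Here \<open>6k/5 \<le> card M + 1 < k + 1\<close>, which fails for
      \<open>k > 100\<close>.\<close>
    then show False using deg[OF pp(1)] deg[OF pp(2)] cM k by simp
  qed
qed

subsection \<open>A nearly perfect cover by big lines\<close>

text \<open>The \<open>t\<close> lines are the exceptional lines of \<open>few_heavy_lines\<close> through a maximal independent set of
  unexceptional points.\<close>

lemma big_lines_cover:
  fixes s :: nat
  assumes s: "s \<ge> 2"
  shows "\<exists>n0. \<forall>n\<ge>n0. \<forall>m P L. admissible s n m P L \<and> m \<le> 2 * n \<longrightarrow>
    (\<exists>H\<subseteq>L. card H = s - 1 \<and> 5 * real (card (P - \<Union>H)) \<le> (real n - 1) / (real s - 1))"
proof -
  define t where "t = s - 1"
  have t: "t \<ge> 1" "s = Suc t" using s by (auto simp: t_def)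
  \<comment> \<open>Chosen so that \<open>t + 1\<close> sets of size \<open>\<gamma> * n\<close>
    have total size at most \<open>k/10\<close>: one for \<open>B2\<close>, and one for the
    neighbours of each point of \<open>I\<close>.\<close>
  define \<gamma> :: real where "\<gamma> = 1 / (20 * real t * (real t + 1))"
  have \<gamma>: "\<gamma> > 0" using t(1) by (simp add: \<gamma>_def)
  obtain j where j: "(9/10 :: real)^j < \<gamma>^2 / 4"
    using real_arch_pow_inv[of "\<gamma>^2 / 4" "9/10"] \<gamma> by auto
  obtain C r where heavy: "\<And>Q :: (real^2) set. finite Q \<Longrightarrow>
     (\<exists>H. finite H \<and> card H \<le> C \<and>
       (\<forall>L. finite L \<and> (\<forall>l\<in>L. line l) \<and> L \<inter> H = {} \<longrightarrow>
          (\<Sum>l\<in>L. (real (card (Q \<inter> l) - r))^2) \<le> (9/10)^j * (real (card Q))^2))"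
    using few_heavy_lines[of j] by blast
  \<comment> \<open>The middle term makes \<open>C * C + t\<close> small against \<open>k\<close>;
    the last one absorbs the \<open>r\<close> points forgiven on each of at most
    \<open>2 * n\<close> lines.\<close>
  define n0 where "n0 = 2 + 20 * t * (C * C + t) + nat \<lceil>8 * (real r)^2 / \<gamma>^2\<rceil>"
  show ?thesis
  proof (rule exI[of _ n0], intro allI impI)
    fix n m P L assume n0: "n \<ge> n0" and "admissible s n m P L \<and> m \<le> 2 * n"
    then have adm: "admissible s n m P L" and m: "m \<le> 2 * n" by auto
    define k where "k = (real n - 1) / (real s - 1)"
    have P: "finite P" "card P = n" and L: "finite L" "card L = m" "\<And>l. l \<in> L \<Longrightarrow> line l"
      and cap: "\<And>l. l \<in> L \<Longrightarrow> real (card (P \<inter> l)) \<le> k"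
      and cov: "\<And>S. S \<subseteq> P \<Longrightarrow> card S = s \<Longrightarrow>
          \<exists>x\<in>S. \<exists>y\<in>S. x \<noteq> y \<and> (\<exists>l\<in>L. x \<in> l \<and> y \<in> l)"
      using adm unfolding admissible_def k_def by auto
    have nt: "real n = real t * k + 1" using t unfolding k_def by simp
    have n_ge: "n \<ge> 2" "n \<ge> 20 * t * (C * C + t) + 2" using n0 unfolding n0_def by linarith+
    have k_ge: "real (C * C + t) \<le> k / 10"
    proof -
      have "real (20 * t * (C * C + t) + 2) \<le> real n" using n_ge(2) by (subst of_nat_le_iff)
      then have "real t * (20 * real (C * C + t)) \<le> real t * k" using nt by (simp add: algebra_simps)
      then have "20 * real (C * C + t) \<le> k" using t(1) by simp
      moreover have "a \<le> k / 10" if "20 * a \<le> k" "0 \<le> a" for a using that by linarith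
      ultimately show ?thesis using of_nat_0_le_iff by blast
    qed
    have k_pos: "k > 0" using n_ge(1) s unfolding k_def by simp
    have \<gamma>n: "(real t + 1) * \<gamma> * real n \<le> k / 10"
    proof -
      have cancel: "c * (1 / (a * c)) = 1 / a" if "c \<noteq> 0" for a c :: real using that by simp
      have "(real t + 1) * \<gamma> = 1 / (20 * real t)"
        unfolding \<gamma>_def by (rule cancel) linarith
      then have "(real t + 1) * \<gamma> * real n = real n / (20 * real t)" by simp
      moreover have "real n \<le> 2 * (real t * k)" using nt n_ge(1) by linarith
      ultimately show ?thesis using t(1) by (simp add: divide_le_eq mult_ac)
    qed
    have r_le: "8 * (real r)^2 \<le> \<gamma>^2 * real n"
    proof -
      have "8 * (real r)^2 / \<gamma>^2 \<le> real (nat \<lceil>8 * (real r)^2 / \<gamma>^2\<rceil>)" by (rule real_nat_ceiling_ge)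
      also have "\<dots> \<le> real n" using n0 unfolding n0_def by linarith
      finally show ?thesis using \<gamma> by (simp add: field_simps)
    qed
    obtain H0 where H0_all: "finite H0 \<and> card H0 \<le> C \<and>
       (\<forall>L. finite L \<and> (\<forall>l\<in>L. line l) \<and> L \<inter> H0 = {} \<longrightarrow>
          (\<Sum>l\<in>L. (real (card (P \<inter> l) - r))^2) \<le> (9/10)^j * (real (card P))^2)"
      using heavy[OF P(1)] ..
    then have H0: "finite H0" "card H0 \<le> C" by simp_all
    have light: "(\<Sum>l\<in>L. (real (card (P \<inter> l) - r))^2) \<le> (9/10)^j * (real (card P))^2"
      if "finite L" "\<forall>l\<in>L. line l" "L \<inter> H0 = {}" for L
      using H0_all that by simp
    define M where "M = L - H0"
    have finM: "finite M" "card M \<le> m" unfolding M_def using L card_mono[of L "L - H0"] by auto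
    define N where "N x = {y \<in> P. \<exists>l\<in>M. x \<in> l \<and> y \<in> l}" for x
    have finN: "finite (N x)" for x unfolding N_def using P by simp
    \<comment> \<open>By \<open>sq\<close>, the truncated squares contribute at most
      \<open>2 * (\<gamma>^2 / 4) * n^2\<close> and the terms with \<open>r\<close> at most
      \<open>4 * n * r^2\<close>; each is at most half of the bound.\<close>
    have sum_sq: "(\<Sum>l\<in>M. (real (card (P \<inter> l)))^2) \<le> \<gamma>^2 * (real n)^2"
    proof -
      have sq: "(real a)^2 \<le> 2 * (real (a - r))^2 + 2 * (real r)^2" for a
      proof -
        have "real a \<le> real (a - r) + real r" by linarith
        then have "(real a)^2 \<le> (real (a - r) + real r)^2" by (intro power_mono) auto
        also have "\<dots> \<le> 2 * (real (a - r))^2 + 2 * (real r)^2"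
          using zero_le_power2[of "real (a - r) - real r"] by (simp add: power2_eq_square algebra_simps)
        finally show ?thesis .
      qed
      have "(\<Sum>l\<in>M. (real (card (P \<inter> l)))^2) \<le> (\<Sum>l\<in>M. 2 * (real (card (P \<inter> l) - r))^2 + 2 * (real r)^2)"
        by (intro sum_mono sq)
      also have "\<dots> = 2 * (\<Sum>l\<in>M. (real (card (P \<inter> l) - r))^2) + real (card M) * (2 * (real r)^2)"
        by (simp add: sum.distrib sum_distrib_left)
      also have "(\<Sum>l\<in>M. (real (card (P \<inter> l) - r))^2) \<le> (9/10)^j * (real (card P))^2"
        using finM L(3) by (intro light) (auto simp: M_def)
      also have "\<dots> \<le> \<gamma>^2 / 4 * (real n)^2"
        unfolding P(2) using j by (intro mult_right_mono) auto
      also have "real (card M) * (2 * (real r)^2) \<le> (2 * real n) * (2 * (real r)^2)"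
        using finM(2) m by (intro mult_right_mono) auto
      also have "\<dots> = real n / 2 * (8 * (real r)^2)" by simp
      also have "\<dots> \<le> real n / 2 * (\<gamma>^2 * real n)" using r_le by (intro mult_left_mono) auto
      finally show ?thesis by (simp add: power2_eq_square)
    qed
    \<comment> \<open>Two kinds of bad points: those on two exceptional lines, and those with many
      neighbours through unexceptional ones. Intersections of line pairs bound the first kind, and a
      Markov argument from \<open>sum_sq\<close> the second.\<close>
    define B1 where "B1 = {x \<in> P. \<exists>h\<in>H0 \<inter> L. \<exists>g\<in>H0 \<inter> L. h \<noteq> g \<and> x \<in> h \<and> x \<in> g}"
    define B2 where "B2 = {x \<in> P. real (card (N x)) > \<gamma> * real n}"
    have finB: "finite B1" "finite B2" unfolding B1_def B2_def using P by auto
    have cB1: "card B1 \<le> C * C"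
    proof -
      define K where "K = {z \<in> (H0 \<inter> L) \<times> (H0 \<inter> L). fst z \<noteq> snd z}"
      have finK: "finite K" unfolding K_def using H0 by (intro finite_Collect_conjI) auto
      have "B1 \<subseteq> (\<Union>z\<in>K. P \<inter> fst z \<inter> snd z)" unfolding B1_def K_def by fastforce
      then have "card B1 \<le> card (\<Union>z\<in>K. P \<inter> fst z \<inter> snd z)"
        using P finK by (intro card_mono) auto
      also have "\<dots> \<le> (\<Sum>z\<in>K. card (P \<inter> fst z \<inter> snd z))" by (rule card_UN_le[OF finK])
      also have "\<dots> \<le> (\<Sum>z\<in>K. 1)"
      proof (rule sum_mono)
        fix z assume "z \<in> K"
        then have "line (fst z)" "line (snd z)" "fst z \<noteq> snd z" using L(3) unfolding K_def by auto
        then show "card (P \<inter> fst z \<inter> snd z) \<le> 1" by (rule card_Int_lines_le_1(2)) auto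
      qed
      also have "\<dots> \<le> card (H0 \<times> H0)"
        unfolding card_eq_sum[symmetric] using H0(1) by (intro card_mono) (auto simp: K_def)
      also have "\<dots> \<le> C * C" using H0 by (simp add: card_cartesian_product mult_le_mono)
      finally show ?thesis .
    qed
    have cB2: "real (card B2) \<le> \<gamma> * real n"
    proof -
      have cN: "card (N x) \<le> (\<Sum>l | l \<in> M \<and> x \<in> l. card (P \<inter> l))" for x
      proof -
        have "N x = (\<Union>l\<in>{l. l \<in> M \<and> x \<in> l}. P \<inter> l)" unfolding N_def by auto
        then show ?thesis using card_UN_le[of "{l. l \<in> M \<and> x \<in> l}" "\<lambda>l. P \<inter> l"] finM by simp
      qed
      have "real (card B2) * (\<gamma> * real n) = (\<Sum>x\<in>B2. \<gamma> * real n)" by simp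
      also have "\<dots> \<le> (\<Sum>x\<in>B2. real (card (N x)))" by (intro sum_mono) (auto simp: B2_def)
      also have "\<dots> \<le> (\<Sum>x\<in>P. real (card (N x)))"
        using P by (intro sum_mono2) (auto simp: B2_def)
      also have "\<dots> \<le> (\<Sum>x\<in>P. real (\<Sum>l | l \<in> M \<and> x \<in> l. card (P \<inter> l)))"
        by (intro sum_mono) (simp only: of_nat_le_iff cN)
      also have "\<dots> = real (\<Sum>l\<in>M. card (P \<inter> l) * card (P \<inter> l))"
        unfolding of_nat_sum[symmetric] sum_incidences[OF P(1) finM(1)] ..
      also have "\<dots> = (\<Sum>l\<in>M. (real (card (P \<inter> l)))^2)" by (simp add: power2_eq_square)
      also have "\<dots> \<le> (\<gamma> * real n) * (\<gamma> * real n)" using sum_sq by (simp add: power2_eq_square mult_ac)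
      finally show ?thesis using \<gamma> n_ge(1) by simp
    qed
    define indep where "indep I \<longleftrightarrow> I \<subseteq> P - (B1 \<union> B2) \<and>
      (\<forall>x\<in>I. \<forall>y\<in>I. x \<noteq> y \<longrightarrow> \<not> (\<exists>l\<in>L. x \<in> l \<and> y \<in> l))" for I
    have "finite {I. indep I}"
      by (rule finite_subset[of _ "Pow P"]) (use P in \<open>auto simp: indep_def\<close>)
    moreover have "{} \<in> {I. indep I}" by (simp add: indep_def)
    ultimately obtain I where I: "indep I" and max: "\<And>J. indep J \<Longrightarrow> I \<subseteq> J \<Longrightarrow> I = J"
      using finite_has_maximal[of "{I. indep I}"] by blast
    have finI: "finite I" using I P unfolding indep_def by (auto intro: finite_subset)
    have cI: "card I \<le> t"
    proof (rule ccontr)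
      assume "\<not> ?thesis"
      then have "s \<le> card I" using t by simp
      then obtain S where S: "S \<subseteq> I" "card S = s" by (rule obtain_subset_with_card_n)
      have "S \<subseteq> P" using S(1) I unfolding indep_def by blast
      then obtain x y l where "x \<in> S" "y \<in> S" "x \<noteq> y" "l \<in> L" "x \<in> l" "y \<in> l"
        using cov[of S] S(2) by blast
      then show False using S(1) I unfolding indep_def by blast
    qed
    define H where "H = {l \<in> L \<inter> H0. \<exists>x\<in>I. x \<in> l}"
    have HL: "H \<subseteq> L" and finH: "finite H" unfolding H_def using H0 by auto
    have cH: "card H \<le> t"
    proof -
      \<comment> \<open>A point of \<open>I\<close> avoids \<open>B1\<close>, so it lies on at most
        one exceptional line of \<open>L\<close>. Picking a point of \<open>I\<close> on each line
        of \<open>H\<close> is therefore injective.\<close>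
      define e where "e l = (SOME x. x \<in> I \<and> x \<in> l)" for l
      have e: "e l \<in> I \<and> e l \<in> l" if "l \<in> H" for l
      proof -
        have "\<exists>x. x \<in> I \<and> x \<in> l" using that unfolding H_def by blast
        then show ?thesis unfolding e_def by (rule someI_ex)
      qed
      have "inj_on e H"
      proof (rule inj_onI, rule ccontr)
        fix l g assume lg: "l \<in> H" "g \<in> H" "e l = e g" "l \<noteq> g"
        have "e l \<in> P" using e[OF lg(1)] I unfolding indep_def by blast
        moreover have "e l \<in> l" using e[OF lg(1)] by simp
        moreover have "e l \<in> g" using e[OF lg(2)] lg(3) by simp
        moreover have "l \<in> H0 \<inter> L" "g \<in> H0 \<inter> L" using lg(1,2) unfolding H_def by auto
        ultimately have "e l \<in> B1" using lg(4) unfolding B1_def by blast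
        then show False using e[OF lg(1)] I unfolding indep_def by blast
      qed
      then have "card H \<le> card I" using e finI by (intro card_inj_on_le[of e]) auto
      then show ?thesis using cI by simp
    qed
    \<comment> \<open>By maximality of \<open>I\<close>, a good point outside \<open>I\<close> is
      joined to some point of \<open>I\<close>: by an exceptional line, which is then in
      \<open>H\<close>, or by a line of \<open>M\<close>, which puts it in some
      \<open>N x\<close>.\<close>
    have cover: "P - \<Union>H \<subseteq> (B1 \<union> B2) \<union> (I \<union> (\<Union>x\<in>I. N x))"
    proof
      fix y assume y: "y \<in> P - \<Union>H"
      show "y \<in> (B1 \<union> B2) \<union> (I \<union> (\<Union>x\<in>I. N x))"
      proof (rule ccontr)
        assume not: "\<not> ?thesis"
        have "\<exists>x\<in>I. \<exists>l\<in>L. x \<in> l \<and> y \<in> l"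
        proof (rule ccontr)
          assume non_adj: "\<not> ?thesis"
          have "insert y I \<subseteq> P - (B1 \<union> B2)" using I y not unfolding indep_def by blast
          moreover have "\<not> (\<exists>l\<in>L. u \<in> l \<and> v \<in> l)"
            if uv: "u \<in> insert y I" "v \<in> insert y I" "u \<noteq> v" for u v
          proof -
            consider "u \<in> I" "v \<in> I" | "u = y" "v \<in> I" | "u \<in> I" "v = y" using uv by blast
            then show ?thesis
            proof cases
              case 1
              then show ?thesis using I uv(3) unfolding indep_def by blast
            qed (use non_adj in blast)+
          qed
          ultimately have "indep (insert y I)" unfolding indep_def by blast
          then have "I = insert y I" by (rule max) blast
          then show False using not by blast
        qed
        then obtain x l where xl: "x \<in> I" "l \<in> L" "x \<in> l" "y \<in> l" by blast
        show False
        proof (cases "l \<in> H0")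
          case True
          then have "l \<in> H" using xl unfolding H_def by blast
          then show False using y xl by blast
        next
          case False
          then have "y \<in> N x" using xl y unfolding N_def M_def by blast
          then show False using not xl by blast
        qed
      qed
    qed
    \<comment> \<open>Half of the allowance \<open>k/5\<close> pays for \<open>B1\<close> and
      \<open>I\<close>, the other half for \<open>B2\<close> and the neighbourhoods
      \<open>N x\<close>.\<close>
    have small: "5 * real (card (P - \<Union>H)) \<le> k"
    proof -
      have "card (P - \<Union>H) \<le> card ((B1 \<union> B2) \<union> (I \<union> (\<Union>x\<in>I. N x)))"
        using cover finB finI finN by (intro card_mono) auto
      also have "\<dots> \<le> card B1 + card B2 + (card I + card (\<Union>x\<in>I. N x))"
        by (intro order_trans[OF card_Un_le] add_mono card_Un_le)
      also have "card (\<Union>x\<in>I. N x) \<le> (\<Sum>x\<in>I. card (N x))" by (rule card_UN_le[OF finI])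
      finally have "real (card (P - \<Union>H)) \<le>
          real (card B1) + real (card B2) + (real (card I) + (\<Sum>x\<in>I. real (card (N x))))"
        unfolding of_nat_sum[symmetric] of_nat_add[symmetric] of_nat_le_iff by simp
      moreover have "(\<Sum>x\<in>I. real (card (N x))) \<le> (\<Sum>x\<in>I. \<gamma> * real n)"
      proof (rule sum_mono)
        fix x assume "x \<in> I"
        then have "x \<in> P" "x \<notin> B2" using I unfolding indep_def by blast+
        then show "real (card (N x)) \<le> \<gamma> * real n" unfolding B2_def by simp
      qed
      moreover have "(\<Sum>x\<in>I. \<gamma> * real n) \<le> real t * (\<gamma> * real n)"
        using cI \<gamma> by (simp add: mult_right_mono)
      moreover have "real (card B1) + real (card I) \<le> real (C * C + t)"
        using cB1 cI by (simp flip: of_nat_add of_nat_mult)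
      moreover have "\<gamma> * real n + real t * (\<gamma> * real n) \<le> k / 10"
        using \<gamma>n by (simp add: algebra_simps)
      ultimately show ?thesis using cB2 k_ge by linarith
    qed
    \<comment> \<open>With at most \<open>t - 1\<close> lines, \<open>H\<close> would cover at most
      \<open>(t - 1) * k\<close> points, and the remaining \<open>k/5\<close> do not bring this up
      to \<open>n = t * k + 1\<close>.\<close>
    have "card H = t"
    proof (rule ccontr)
      assume "card H \<noteq> t"
      then have "card H \<le> t - 1" using cH by linarith
      then have H1: "real (card H) \<le> real t - 1" using t(1) by linarith
      have "P \<subseteq> (\<Union>h\<in>H. P \<inter> h) \<union> (P - \<Union>H)" by auto
      then have "card P \<le> card ((\<Union>h\<in>H. P \<inter> h) \<union> (P - \<Union>H))"
        using P(1) finH by (intro card_mono) auto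
      also have "\<dots> \<le> card (\<Union>h\<in>H. P \<inter> h) + card (P - \<Union>H)" by (rule card_Un_le)
      also have "card (\<Union>h\<in>H. P \<inter> h) \<le> (\<Sum>h\<in>H. card (P \<inter> h))" by (rule card_UN_le[OF finH])
      finally have "real n \<le> (\<Sum>h\<in>H. real (card (P \<inter> h))) + real (card (P - \<Union>H))"
        unfolding of_nat_sum[symmetric] of_nat_add[symmetric] of_nat_le_iff P(2) by simp
      also have "(\<Sum>h\<in>H. real (card (P \<inter> h))) \<le> (\<Sum>h\<in>H. k)" using cap HL by (intro sum_mono) auto
      also have "\<dots> \<le> (real t - 1) * k" using H1 k_pos by (simp add: mult_right_mono)
      finally show False using small k_pos nt by (simp add: algebra_simps)
    qed
    then show "\<exists>H\<subseteq>L. card H = s - 1 \<and> 5 * real (card (P - \<Union>H)) \<le> (real n - 1) / (real s - 1)"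
      using HL small unfolding k_def t_def by blast
  qed
qed

subsection \<open>The extremal configuration\<close>

definition pt :: "real \<Rightarrow> real \<Rightarrow> real^2" where "pt x y = vector [x, y]"

lemma pt_nth [simp]: "pt x y $ 1 = x" "pt x y $ 2 = y"
  by (simp_all add: pt_def)

lemma pt_eq_iff [simp]: "pt x y = pt x' y' \<longleftrightarrow> x = x' \<and> y = y'"
  by (metis pt_nth)

text \<open>A \<open>k\<close> by \<open>t\<close> grid, covered by its \<open>t\<close> rows, together with one further point, which is joined to
  each of the \<open>k\<close> points of the bottom row.\<close>

lemma grid_plus_point_admissible:
  assumes t: "t \<ge> 1" and k: "k \<ge> t + 1"
  shows "\<exists>P L. admissible (t + 1) (t * k + 1) (t + k) P L"
proof -
  define G where "G = (\<lambda>(j, i). pt (real j) (real i)) ` ({..<k} \<times> {..<t})"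
  define p where "p = pt 0 (- 1)"
  define row where "row i = {x :: real^2. x $ 2 = real i}" for i :: nat
  \<comment> \<open>The full line through \<open>p\<close> and the bottom-row point
    \<open>pt j 0\<close>.\<close>
  define ray where "ray j = {x :: real^2. x $ 1 = real j * (x $ 2 + 1)}" for j :: nat
  define P where "P = insert p G"
  define L where "L = row ` {..<t} \<union> ray ` {..<k}"
  have GE: "\<exists>j<k. \<exists>i<t. x = pt (real j) (real i)" if "x \<in> G" for x
    using that unfolding G_def by auto
  have pG: "p \<notin> G"
  proof
    assume "p \<in> G"
    then obtain j i :: nat where "p = pt (real j) (real i)" using GE by blast
    then show False unfolding p_def by simp
  qed
  have cG: "card G = t * k"
    unfolding G_def by (subst card_image) (auto simp: inj_on_def card_cartesian_product)
  have finG: "finite G" unfolding G_def by simp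
  have cP: "card P = t * k + 1" unfolding P_def using pG finG cG by simp
  have inj_row: "inj_on row {..<t}"
  proof (rule inj_onI)
    fix i i' assume "row i = row i'"
    moreover have "pt 0 (real i) \<in> row i" by (simp add: row_def)
    ultimately have "pt 0 (real i) \<in> row i'" by simp
    then show "i = i'" by (simp add: row_def)
  qed
  have inj_ray: "inj_on ray {..<k}"
  proof (rule inj_onI)
    fix j j' assume "ray j = ray j'"
    moreover have "pt (real j) 0 \<in> ray j" by (simp add: ray_def)
    ultimately have "pt (real j) 0 \<in> ray j'" by simp
    then show "j = j'" by (simp add: ray_def)
  qed
  have p_ray: "p \<in> ray j" and p_row: "p \<notin> row i" for i j
    by (simp_all add: p_def ray_def row_def)
  have "row ` {..<t} \<inter> ray ` {..<k} = {}" using p_ray p_row by blast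
  then have cL: "card L = t + k"
    unfolding L_def using inj_row inj_ray by (subst card_Un_disjoint) (auto simp: card_image)
  have lines: "line l" if "l \<in> L" for l
  proof -
    have "line (row i)" for i
      unfolding line_iff_equation row_def by (rule exI[of _ 0], rule exI[of _ 1]) auto
    moreover have "line (ray j)" for j
      unfolding line_iff_equation ray_def
      by (rule exI[of _ 1], rule exI[of _ "- real j"], rule exI[of _ "real j"]) (auto simp: algebra_simps)
    ultimately show ?thesis using that unfolding L_def by blast
  qed
  have cap: "card (P \<inter> l) \<le> k" if "l \<in> L" for l
  proof -
    have "card (P \<inter> row i) \<le> k" for i
    proof -
      have "P \<inter> row i \<subseteq> (\<lambda>j. pt (real j) (real i)) ` {..<k}"
        using p_row GE unfolding P_def row_def by fastforce
      then have "card (P \<inter> row i) \<le> card ((\<lambda>j. pt (real j) (real i)) ` {..<k})"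
        by (intro card_mono) auto
      also have "\<dots> \<le> card {..<k}" by (rule card_image_le) simp
      finally show ?thesis by simp
    qed
    \<comment> \<open>On \<open>ray j\<close> the height determines the point, and only the heights
      -1 and \<open>0, ..., t - 1\<close> occur in \<open>P\<close>. This gives \<open>t + 1\<close>
      points at most, whence the assumption on \<open>k\<close>.\<close>
    moreover have "card (P \<inter> ray j) \<le> k" for j
    proof -
      have "inj_on (\<lambda>x. x $ 2) (P \<inter> ray j)"
        by (rule inj_onI) (auto simp: ray_def vec_eq_iff forall_2)
      moreover have "(\<lambda>x. x $ 2) ` (P \<inter> ray j) \<subseteq> insert (- 1) (real ` {..<t})"
        using GE unfolding P_def p_def by fastforce
      ultimately have "card (P \<inter> ray j) \<le> card (insert (- 1) (real ` {..<t}))"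
        by (intro card_inj_on_le) auto
      also have "\<dots> \<le> t + 1" by (rule order_trans[OF card_insert_le_m1]) (auto simp: card_image)
      finally show ?thesis using k by simp
    qed
    ultimately show ?thesis using that unfolding L_def by blast
  qed
  \<comment> \<open>Two points of \<open>S - {p}\<close> at equal height share a row. Otherwise the
    \<open>t\<close> possible heights force \<open>p \<in> S\<close> and every height to occur, so
    the point at height 0 is joined to \<open>p\<close> by a \<open>ray\<close>.\<close>
  have cov: "\<exists>x\<in>S. \<exists>y\<in>S. x \<noteq> y \<and> (\<exists>l\<in>L. x \<in> l \<and> y \<in> l)" if S: "S \<subseteq> P" "card S = t + 1" for S
  proof (cases "inj_on (\<lambda>x. x $ 2) (S - {p})")
    case True
    have img: "(\<lambda>x. x $ 2) ` (S - {p}) \<subseteq> real ` {..<t}"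
      using S(1) GE unfolding P_def by fastforce
    have cimg: "card ((\<lambda>x. x $ 2) ` (S - {p})) = card (S - {p})"
      using True by (rule card_image)
    have ct: "card (real ` {..<t}) = t" by (simp add: card_image)
    have le: "card (S - {p}) \<le> t"
      using card_mono[OF _ img] cimg ct by simp
    have pS: "p \<in> S"
    proof (rule ccontr)
      assume "p \<notin> S"
      then show False using le S(2) by simp
    qed
    have "finite S" using S(2) by (intro card_ge_0_finite) simp
    then have "card (S - {p}) = t" using pS S(2) by simp
    then have "(\<lambda>x. x $ 2) ` (S - {p}) = real ` {..<t}"
      using cimg ct by (intro card_subset_eq[OF _ img]) auto
    moreover have "0 \<in> real ` {..<t}" using t by (intro image_eqI[of _ _ 0]) auto
    ultimately have "0 \<in> (\<lambda>x. x $ 2) ` (S - {p})" by simp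
    then obtain x where "0 = x $ 2" "x \<in> S - {p}" by (rule imageE)
    then have x: "x \<in> S" "x \<noteq> p" "x $ 2 = 0" by simp_all
    then obtain j i where ji: "j < k" "x = pt (real j) (real i)" using S(1) GE unfolding P_def by blast
    have "x \<in> ray j" using x(3) ji(2) by (simp add: ray_def)
    moreover have "ray j \<in> L" using ji(1) unfolding L_def by blast
    ultimately show ?thesis using x(1,2) pS p_ray[of j] by blast
  next
    case False
    then obtain x y where xy: "x \<in> S" "y \<in> S" "x \<noteq> p" "x \<noteq> y" "x $ 2 = y $ 2"
      unfolding inj_on_def by blast
    then obtain j i where ji: "i < t" "x = pt (real j) (real i)" using S(1) GE unfolding P_def by blast
    have "x \<in> row i" "y \<in> row i" using xy(5) ji(2) by (simp_all add: row_def)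
    moreover have "row i \<in> L" using ji(1) unfolding L_def by blast
    ultimately show ?thesis using xy by blast
  qed
  have "real (card (P \<inter> l)) \<le> (real (t * k + 1) - 1) / (real (t + 1) - 1)" if "l \<in> L" for l
    using cap[OF that] t by simp
  then have "admissible (t + 1) (t * k + 1) (t + k) P L"
    unfolding admissible_def using cP cL finG lines cov by (simp add: P_def L_def)
  then show ?thesis by blast
qed

section \<open>Combination of the lower bound and the construction\<close>

theorem corollary1:
  fixes s :: nat
  assumes "s \<ge> 2"
  shows "(\<exists>n0::nat. \<forall>n\<ge>n0. \<forall>m P L. admissible s n m P L \<longrightarrow>
            real m \<ge> (real n - 1) / (real s - 1) + real s - 1)
       \<and> (\<exists>n1::nat. \<forall>n\<ge>n1. (int s - 1) dvd (int n - 1) \<longrightarrow>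
            (\<exists>m P L. admissible s n m P L \<and>
               real m = (real n - 1) / (real s - 1) + real s - 1))"
proof
  define t where "t = s - 1"
  have t: "t \<ge> 1" and s: "s = t + 1" using assms by (auto simp: t_def)
  obtain n0 where n0: "\<And>n m P L. n \<ge> n0 \<Longrightarrow> admissible s n m P L \<Longrightarrow> m \<le> 2 * n \<Longrightarrow>
    \<exists>H\<subseteq>L. card H = s - 1 \<and> 5 * real (card (P - \<Union>H)) \<le> (real n - 1) / (real s - 1)"
    using big_lines_cover[OF assms] by blast
  show "\<exists>n0::nat. \<forall>n\<ge>n0. \<forall>m P L. admissible s n m P L \<longrightarrow>
            real m \<ge> (real n - 1) / (real s - 1) + real s - 1"
  \<comment> \<open>The term \<open>100 * t * t\<close> yields \<open>k > 100 * t\<close>; the term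
    \<open>t\<close> helps to turn the negated bound into \<open>m \<le> 2 * n\<close>, as
    \<open>big_lines_cover\<close> demands.\<close>
  proof (rule exI[of _ "n0 + 100 * t * t + t + 2"], intro allI impI, rule ccontr)
    fix n m P L
    assume n: "n \<ge> n0 + 100 * t * t + t + 2" and adm: "admissible s n m P L"
      and "\<not> real m \<ge> (real n - 1) / (real s - 1) + real s - 1"
    then have few: "real m < (real n - 1) / real t + real t" by (simp add: s)
    have "(real n - 1) / real t \<le> real n - 1" using t n by (simp add: divide_le_eq)
    moreover have "real t \<le> real n" using n by simp
    ultimately have "m \<le> 2 * n" using few by linarith
    then obtain H where H: "H \<subseteq> L" "card H = s - 1"
      "5 * real (card (P - \<Union>H)) \<le> (real n - 1) / (real s - 1)"
      using n0[of n m P L] n adm by auto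
    have "real (100 * t * t + 2) \<le> real n" using n by (subst of_nat_le_iff) linarith
    then have "(real n - 1) / (real s - 1) > 100 * (real s - 1)"
      using t unfolding s by (simp add: less_divide_eq)
    then have "(real n - 1) / (real s - 1) \<le> real (card (L - H))"
      by (rule lines_outside_big_lines[OF adm assms H])
    moreover have "finite L" "card L = m" using adm unfolding admissible_def by auto
    then have "m = card H + card (L - H)"
      using H(1) by (metis card_Diff_subset card_mono finite_subset le_add_diff_inverse)
    ultimately show False using few H(2) unfolding s by simp
  qed
  show "\<exists>n1::nat. \<forall>n\<ge>n1. (int s - 1) dvd (int n - 1) \<longrightarrow>
            (\<exists>m P L. admissible s n m P L \<and>
               real m = (real n - 1) / (real s - 1) + real s - 1)"
  \<comment> \<open>With \<open>n = t * k + 1\<close> this threshold says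
    \<open>k \<ge> t + 1\<close>, as the grid needs.\<close>
  proof (rule exI[of _ "t * (t + 1) + 1"], intro allI impI)
    fix n assume n: "n \<ge> t * (t + 1) + 1" and dvd: "(int s - 1) dvd (int n - 1)"
    have "int s - 1 = int t" "int n - 1 = int (n - 1)" using n by (auto simp: s of_nat_diff)
    then have "int t dvd int (n - 1)" using dvd by (simp only:)
    then have "t dvd n - 1" by (simp only: of_nat_dvd_iff)
    then obtain k where "n - 1 = t * k" by (rule dvdE)
    then have k: "n = t * k + 1" using n by linarith
    have "t * (t + 1) \<le> t * k" using n k by linarith
    then have "t + 1 \<le> k" using t by (subst (asm) mult_le_cancel1) simp
    then obtain P L where "admissible (t + 1) (t * k + 1) (t + k) P L"
      using grid_plus_point_admissible[OF t] by blast
    then show "\<exists>m P L. admissible s n m P L \<and>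
               real m = (real n - 1) / (real s - 1) + real s - 1"
      using t unfolding s k by (intro exI[of _ "t + k"] exI[of _ P] exI[of _ L]) simp
  qed
qed

end
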